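(* Let $a,b,c$ be entire functions of order less than $1$, none of them identically zero and not all constants, and let $n\ge1$ be an integer such that $a^{\underline{n}},b^{\underline{n}},c^{\underline{n}}$ are relatively shifting prime and satisfy $$a^{\underline{n}}+b^{\underline{n}}=c^{\underline{n}}.$$ Then $n\le2$. In addition, if one of $a,b,c$ is a constant, then $n=1$.
   Context: For an entire function $f$ and an integer $n\ge1$, $f^{\underline{n}}:=f(z)f(z-1)\cdots f(z-n+1)$. In particular $(z-z_0)^{\underline{n}}=(z-z_0)(z-z_0-1)\cdots(z-z_0-n+1)$. $\Delta f(z)=f(z+1)-f(z)$, $\Delta^0f=f$, $\Delta^k f=\Delta(\Delta^{k-1}f)$. Length of zeros. For an entire function $f$, a point $z_0$ is a zero of $f$ with length $n\ge 1$ if $\Delta^k f(z_0)=0$ for all $0\le k<n$ and $\Delta^n f(z_0)\ne0$. Relatively shifting prime. Let $f,g$ be entire, let $z_1$ be a zero of $f$ with length $m'$ and $z_2$ a zero of $g$ with length $n'$. For $1\le m_1\le m'$ and $1\le n_1\le n'$ there are entire $F,G$ with $f(z)=(z-z_1)^{\underline{m_1}}F(z)$ and $g(z)=(z-z_2)^{\underline{n_1}}G(z)$. If for some such $m_1,n_1$ one has $f(z)g(z)=(z-z_0)^{\underline{m_1+n_1}}F(z)G(z)$ with $z_0\in\{z_1,z_2\}$, then $z-z_0$ is called a common shifting divisor of $f$ and $g$. If $f$ and $g$ have no common shifting divisor (for any choice of $z_1,z_2$), they are called relatively shifting prime. Three functions are relatively shifting prime if they are so pairwise. *)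

theory Defs
  imports "HOL-Complex_Analysis.Complex_Analysis"
begin

definition max_modulus :: "(complex \<Rightarrow> complex) \<Rightarrow> real \<Rightarrow> real" where
  "max_modulus f r = (SUP z\<in>sphere 0 r. norm (f z))"

definition ln_plus :: "real \<Rightarrow> real" where
  "ln_plus x = ln (max 1 x)"

text \<open>
  The order of growth of an entire function, the upper limit of
  \<open>log log M(r, f) / log r\<close> as \<open>r\<close> tends to infinity. The logarithms are truncated at \<open>0\<close>
  so that bounded functions, where \<open>log log M(r, f)\<close> may be undefined, have order \<open>0\<close>.
\<close>
definition growth_order :: "(complex \<Rightarrow> complex) \<Rightarrow> ereal" where
  "growth_order f = Limsup at_top (\<lambda>r. ereal (ln_plus (ln_plus (max_modulus f r)) / ln r))"

definition falling_power :: "(complex \<Rightarrow> complex) \<Rightarrow> nat \<Rightarrow> complex \<Rightarrow> complex" where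
  "falling_power f n z = (\<Prod>k<n. f (z - of_nat k))"

definition fdiff :: "(complex \<Rightarrow> complex) \<Rightarrow> complex \<Rightarrow> complex" where
  "fdiff f z = f (z + 1) - f z"

definition zero_of_length :: "(complex \<Rightarrow> complex) \<Rightarrow> complex \<Rightarrow> nat \<Rightarrow> bool" where
  "zero_of_length f z0 n \<longleftrightarrow>
     n \<ge> 1 \<and> (\<forall>k<n. (fdiff ^^ k) f z0 = 0) \<and> (fdiff ^^ n) f z0 \<noteq> 0"

text \<open>
  \<open>common_shifting_divisor f g z0\<close> says that \<open>z - z0\<close> is a common shifting divisor of the
  entire functions \<open>f\<close> and \<open>g\<close>. A mere common zero need not give one: the identity has no
  common shifting divisor with itself.
\<close>
definition common_shifting_divisor ::
  "(complex \<Rightarrow> complex) \<Rightarrow> (complex \<Rightarrow> complex) \<Rightarrow> complex \<Rightarrow> bool" where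
  "common_shifting_divisor f g z0 \<longleftrightarrow>
     (\<exists>z1 z2 m' n' m1 n1 F G.
        zero_of_length f z1 m' \<and> zero_of_length g z2 n' \<and>
        1 \<le> m1 \<and> m1 \<le> m' \<and> 1 \<le> n1 \<and> n1 \<le> n' \<and>
        F holomorphic_on UNIV \<and> G holomorphic_on UNIV \<and>
        (\<forall>z. f z = falling_power (\<lambda>w. w - z1) m1 z * F z) \<and>
        (\<forall>z. g z = falling_power (\<lambda>w. w - z2) n1 z * G z) \<and>
        z0 \<in> {z1, z2} \<and>
        (\<forall>z. f z * g z = falling_power (\<lambda>w. w - z0) (m1 + n1) z * F z * G z))"

definition rel_shifting_prime ::
  "(complex \<Rightarrow> complex) \<Rightarrow> (complex \<Rightarrow> complex) \<Rightarrow> bool" where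
  "rel_shifting_prime f g \<longleftrightarrow> (\<nexists>z0. common_shifting_divisor f g z0)"

definition rel_shifting_prime3 ::
  "(complex \<Rightarrow> complex) \<Rightarrow> (complex \<Rightarrow> complex) \<Rightarrow> (complex \<Rightarrow> complex) \<Rightarrow> bool" where
  "rel_shifting_prime3 f g h \<longleftrightarrow>
     rel_shifting_prime f g \<and> rel_shifting_prime f h \<and> rel_shifting_prime g h"

end

theory Submission
  imports Defs "HOL-Real_Asymp.Real_Asymp"
begin

text \<open>
  Let \<open>f, g, h\<close> be the \<open>n\<close>-th falling powers of \<open>a, b, c\<close>, let \<open>P = a b c\<close>, and let
  \<open>W(z) = f(z) g(z + 1) - f(z + 1) g(z)\<close>. Up to sign, \<open>W\<close> is unchanged when another pair of
  \<open>f, g, h\<close> is used. For \<open>n \<ge> 2\<close> shifting primeness forbids common zeros, so the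
  product of \<open>P(z - k)\<close> over \<open>k < n - 1\<close> divides \<open>W\<close>, with an entire quotient \<open>H\<close>.

  A function of order less than one satisfies \<open>a(z + s) / a(z) \<rightarrow> 1\<close> on suitable arbitrarily large
  circles, so there \<open>W\<close> is small compared with each of \<open>f g\<close>, \<open>f h\<close>, \<open>g h\<close>. If \<open>n \<ge> 3\<close>,
  multiplying the three estimates shows that \<open>H(z)\<^sup>3\<close> times the product of \<open>P(z - k)\<close> over
  \<open>2 \<le> k < n - 1\<close>, an entire function, tends to \<open>0\<close> on these circles and so vanishes. If \<open>n = 2\<close>
  and \<open>a\<close> is constant, the estimates for \<open>f g\<close> and \<open>f h\<close> give the same for \<open>H(z)\<^sup>2\<close>. Hence
  \<open>W = 0\<close>, so a zero of \<open>f\<close> at \<open>z\<close> propagates to \<open>z + 1\<close>, \<open>z + 2\<close> and so on, which the zero-free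
  circles exclude. So \<open>a, b, c\<close> have no zeros; then \<open>a(z + s) / a(z)\<close> is
  entire and identically \<open>1\<close>, and likewise for \<open>b\<close> and \<open>c\<close>.
\<close>

section \<open>Shifts of entire functions of order less than one\<close>

text \<open>The Moebius map \<open>u / (2 * A - u)\<close> fixes 0 and sends the half-plane
  \<open>Re u < A\<close> into the unit disc, so the Schwarz lemma applies to its composition with
  the rescaled \<open>h\<close>.\<close>

lemma borel_caratheodory_zero:
  fixes h :: "complex \<Rightarrow> complex"
  assumes h: "h holomorphic_on ball 0 R" "h 0 = 0"
    and Re: "\<And>z. norm z < R \<Longrightarrow> Re (h z) < A"
    and z: "norm z < R"
  shows "norm (h z) * (R - norm z) \<le> 2 * A * norm z"
proof -
  have R: "R > 0" using z norm_ge_zero[of z] by linarith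
  have A: "A > 0" using Re[of 0] R h(2) by simp
  define q where "q w = h (of_real R * w) / (2 * of_real A - h (of_real R * w))" for w
  have inR: "norm (of_real R * w) < R" if "norm w < 1" for w :: complex
    using that R by (simp add: norm_mult)
  have nz: "2 * of_real A - h w \<noteq> 0" if "norm w < R" for w
    using Re[OF that] A by (auto simp: complex_eq_iff)
  have lt: "norm (h w) < norm (2 * of_real A - h w)" if "norm w < R" for w
  proof -
    have "(norm (2 * of_real A - h w))\<^sup>2 - (norm (h w))\<^sup>2 = 4 * A * (A - Re (h w))"
      unfolding cmod_power2 by (simp add: power2_eq_square algebra_simps)
    also have "\<dots> > 0" using Re[OF that] A by simp
    finally show ?thesis by (simp add: power2_less_imp_less)
  qed
  have holo: "(\<lambda>w. h (of_real R * w)) holomorphic_on ball 0 1"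
  proof (rule holomorphic_on_compose_gen[where g = h and t = "ball 0 R", unfolded o_def])
    show "(\<lambda>w. of_real R * w) ` ball 0 1 \<subseteq> ball (0::complex) R"
      using inR by auto
  qed (auto intro!: holomorphic_intros h)
  have "norm (q (z / of_real R)) \<le> norm (z / of_real R)"
  proof (rule Schwarz_Lemma(1))
    show "q holomorphic_on ball 0 1"
      unfolding q_def using inR nz by (intro holomorphic_intros holo) auto
    show "q 0 = 0" by (simp add: q_def h)
    show "norm (q w) < 1" if "norm w < 1" for w
      using lt[OF inR[OF that]] nz[OF inR[OF that]] by (simp add: q_def norm_divide)
    show "norm (z / of_real R) < 1" using z R by (simp add: norm_divide)
  qed
  then have "norm (h z) / norm (2 * of_real A - h z) \<le> norm z / R"
    using R by (simp add: q_def norm_divide)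
  moreover have "norm (2 * of_real A - h z) > 0" using nz[OF z] by simp
  ultimately have "norm (h z) * R \<le> norm z * norm (2 * of_real A - h z)"
    using R by (simp add: field_simps)
  also have "\<dots> \<le> norm z * (2 * A + norm (h z))"
    using norm_triangle_ineq4[of "2 * of_real A" "h z"] A
    by (intro mult_left_mono) (auto simp: norm_mult)
  finally show ?thesis by (simp add: algebra_simps)
qed

lemma norm_exp_minus_one_le:
  fixes z :: complex
  shows "norm (exp z - 1) \<le> exp (norm z) - 1"
proof -
  have s: "(\<lambda>n. z ^ Suc n /\<^sub>R fact (Suc n)) sums (exp z - 1)"
    using sums_Suc_iff[of "\<lambda>n. z ^ n /\<^sub>R fact n" "exp z - 1"] exp_converges[of z] by simp
  have t: "(\<lambda>n. norm z ^ Suc n /\<^sub>R fact (Suc n)) sums (exp (norm z) - 1)"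
    using sums_Suc_iff[of "\<lambda>n. norm z ^ n /\<^sub>R fact n" "exp (norm z) - 1"] exp_converges[of "norm z"] by simp
  show ?thesis
    using norm_suminf_le[OF _ sums_summable[OF t], of "\<lambda>n. z ^ Suc n /\<^sub>R fact (Suc n)"]
      sums_unique[OF s] sums_unique[OF t] 
    by (simp add: norm_power norm_mult norm_divide)
qed

text \<open>A zero-free function on a ball has a logarithm there, and \<open>B\<close> bounds its
  real part. Borel-Caratheodory turns this into a bound for the whole normalised logarithm
  \<open>h\<close> on the ball of half the radius, Cauchy's inequality into a bound for
  \<open>deriv h\<close>, and integration along the step into a bound for the change of
  \<open>h\<close> from \<open>z\<close> to \<open>z + s\<close>.\<close>

lemma zero_free_shift_ratio:
  fixes F :: "complex \<Rightarrow> complex"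
  assumes F: "F holomorphic_on ball 0 R" "\<And>z. norm z < R \<Longrightarrow> F z \<noteq> 0"
    and B: "\<And>z. norm z < R \<Longrightarrow> norm (F z) \<le> B"
    and z: "norm z \<le> R / 4" and s: "norm s \<le> R / 8" and R: "R > 0"
  shows "norm (F (z + s) / F z - 1) \<le> exp (16 * (1 + ln (B / norm (F 0))) * norm s / R) - 1"
proof -
  \<comment> \<open>The summand 1 makes the bound \<open>Re (h w) < A\<close> strict.\<close>
  define A where "A = 1 + ln (B / norm (F 0))"
  obtain \<phi> where \<phi>: "\<phi> holomorphic_on ball 0 R" "\<And>z. z \<in> ball 0 R \<Longrightarrow> exp (\<phi> z) = F z"
    using holomorphic_logarithm_exists[OF convex_ball open_ball F(1), of 0] F(2) R by auto
  define h where "h z = \<phi> z - \<phi> 0" for z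
  have h: "h holomorphic_on ball 0 R" "h 0 = 0"
    unfolding h_def by (auto intro!: holomorphic_intros \<phi>)
  have F0: "F 0 \<noteq> 0" using F(2)[of 0] R by simp
  have eh: "exp (h w) = F w / F 0" if "norm w < R" for w
    using that R \<phi>(2)[of w] \<phi>(2)[of 0] by (simp add: h_def exp_diff)
  have Re: "Re (h w) < A" if "norm w < R" for w
  proof -
    have "exp (Re (h w)) = norm (F w) / norm (F 0)"
      using eh[OF that] by (metis norm_exp_eq_Re norm_divide)
    also have "\<dots> \<le> B / norm (F 0)" using B[OF that] by (simp add: divide_right_mono)
    finally have "Re (h w) \<le> ln (B / norm (F 0))"
      by (smt (verit, best) exp_gt_zero ln_exp ln_mono)
    then show ?thesis by (simp add: A_def)
  qed
  have A: "A > 0" using Re[of 0] R h(2) by simp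
  have hb: "norm (h w) \<le> 2 * A" if "norm w \<le> R / 2" for w
  proof -
    have "norm (h w) * (R / 2) \<le> norm (h w) * (R - norm w)"
      using that by (intro mult_left_mono) auto
    also have "\<dots> \<le> 2 * A * norm w"
      by (rule borel_caratheodory_zero[OF h Re]) (use that R in auto)
    also have "\<dots> \<le> 2 * A * (R / 2)" using that A by (intro mult_left_mono) auto
    finally show ?thesis using R by simp
  qed
  \<comment> \<open>Discs of radius \<open>R / 8\<close> about these points stay within radius
    \<open>R / 2\<close>, where \<open>hb\<close> applies; and
    \<open>R / 4 + R / 8 = 3 * R / 8\<close> keeps \<open>z + s\<close> in range.\<close>
  have dh: "norm (deriv h w) \<le> 16 * A / R" if w: "norm w \<le> 3 * R / 8" for w
  proof -
    have sub: "cball w (R / 8) \<subseteq> ball 0 R"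
    proof
      fix x assume "x \<in> cball w (R / 8)"
      then have "norm x \<le> norm w + R / 8"
        using norm_triangle_ineq3[of x w] by (simp add: dist_norm norm_minus_commute)
      then show "x \<in> ball 0 R" using w R by simp
    qed
    have "norm ((deriv ^^ 1) h w) \<le> fact 1 * (2 * A) / (R / 8) ^ 1"
    proof (rule Cauchy_inequality)
      show "h holomorphic_on ball w (R / 8)"
        using h(1) sub ball_subset_cball holomorphic_on_subset by blast
      show "continuous_on (cball w (R / 8)) h"
        using h(1) sub holomorphic_on_imp_continuous_on holomorphic_on_subset by blast
      fix x assume "norm (w - x) = R / 8"
      then have "norm x \<le> R / 2"
        using norm_triangle_ineq3[of x w] w by (simp add: norm_minus_commute)
      then show "norm (h x) \<le> 2 * A" by (rule hb)
    qed (use R in auto)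
    then show ?thesis by simp
  qed
  have "norm (z + s) \<le> 3 * R / 8" using norm_triangle_ineq[of z s] z s by simp
  then have "norm (h (z + s) - h z) \<le> 16 * A / R * norm (z + s - z)"
  proof (intro field_differentiable_bound[where S = "cball 0 (3 * R / 8)"])
    fix w :: complex assume "w \<in> cball 0 (3 * R / 8)"
    then have w: "norm w \<le> 3 * R / 8" by simp
    then have "w \<in> ball 0 R" using R by simp
    then show "(h has_field_derivative deriv h w) (at w within cball 0 (3 * R / 8))"
      using holomorphic_derivI[OF h(1) open_ball] by (metis has_field_derivative_at_within)
    show "norm (deriv h w) \<le> 16 * A / R" by (rule dh[OF w])
  qed (use z R in auto)
  then have hd: "norm (h (z + s) - h z) \<le> 16 * A * norm s / R" by simp
  have "norm (z + s) < R" "norm z < R"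
    using \<open>norm (z + s) \<le> 3 * R / 8\<close> z R by auto
  then have "F (z + s) / F z = exp (h (z + s) - h z)"
    using eh F0 by (simp add: exp_diff)
  then have "norm (F (z + s) / F z - 1) \<le> exp (norm (h (z + s) - h z)) - 1"
    by (simp add: norm_exp_minus_one_le)
  also have "\<dots> \<le> exp (16 * A * norm s / R) - 1" using hd by simp
  finally show ?thesis by (simp add: A_def)
qed

section \<open>Splitting off the zeros in a disc\<close>

lemma extract_zero:
  fixes F :: "complex \<Rightarrow> complex"
  assumes F: "F holomorphic_on UNIV" "F x = 0"
  obtains G where "G holomorphic_on UNIV" "\<And>z. F z = (z - x) * G z"
proof -
  let ?G = "\<lambda>z. if z = x then deriv F x else (F z - F x) / (z - x)"
  have 1: "?G holomorphic_on UNIV" by (rule pole_lemma_open[OF F(1) open_UNIV])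
  show ?thesis by (rule that[OF 1]) (use F(2) in auto)
qed

text \<open>The maximum principle carries the gain of a factor 2 per listed zero from the large
  circle to its interior. Evaluated at 0 it bounds the number of zeros, in place of Jensen's
  formula.\<close>

lemma norm_factor_le:
  fixes f F :: "complex \<Rightarrow> complex"
  assumes f: "\<And>z. f z = (\<Prod>x\<leftarrow>xs. 1 - z / x) * F z" and F: "F holomorphic_on UNIV"
    and xs: "\<And>x. x \<in> set xs \<Longrightarrow> x \<noteq> 0 \<and> norm x \<le> R" and R: "R > 0"
    and B: "\<And>z. norm z = 3 * R \<Longrightarrow> norm (f z) \<le> B"
    and z: "norm z \<le> 3 * R"
  shows "norm (F z) * 2 ^ length xs \<le> B"
proof -
  have "norm (F z) \<le> B / 2 ^ length xs"
  proof (rule maximum_modulus_frontier[where f = F and \<xi> = z and S = "cball 0 (3 * R)"])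
    show "F holomorphic_on interior (cball 0 (3 * R))"
      using F holomorphic_on_subset by blast
    show "continuous_on (closure (cball 0 (3 * R))) F"
      using F holomorphic_on_imp_continuous_on holomorphic_on_subset by blast
    show "z \<in> cball 0 (3 * R)" using z by simp
    fix w :: complex assume "w \<in> frontier (cball 0 (3 * R))"
    then have w: "norm w = 3 * R" using R by simp
    have "2 ^ length xs \<le> norm (\<Prod>x\<leftarrow>xs. 1 - w / x)"
      using xs
    proof (induction xs)
      case (Cons x xs)
      have x: "x \<noteq> 0" "norm x \<le> R" using Cons.prems by auto
      have "3 \<le> norm w / norm x" using x w R by (simp add: field_simps)
      then have "2 \<le> norm (1 - w / x)"
        using norm_triangle_ineq3[of "w / x" 1] by (simp add: norm_divide norm_minus_commute)
      then show ?case using Cons by (auto simp: norm_mult intro!: mult_mono)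
    qed simp
    then have "2 ^ length xs * norm (F w) \<le> norm (f w)"
      by (simp add: f norm_mult mult_right_mono)
    also have "\<dots> \<le> B" by (rule B[OF w])
    finally show "norm (F w) \<le> B / 2 ^ length xs" by (simp add: field_simps)
  qed simp
  then show ?thesis by (simp add: field_simps)
qed

text \<open>
  A factorization with the longest possible list of zeros leaves a zero-free cofactor; the
  length is bounded because every factor is at least \<open>2\<close> in modulus on the circle of radius \<open>3R\<close>.
\<close>
lemma zero_factorization:
  fixes f :: "complex \<Rightarrow> complex"
  assumes f: "f holomorphic_on UNIV" "f 0 \<noteq> 0" and R: "R > 0"
    and B: "\<And>z. norm z \<le> 3 * R \<Longrightarrow> norm (f z) \<le> B"
  obtains xs F where "F holomorphic_on UNIV" "\<And>z. f z = (\<Prod>x\<leftarrow>xs. 1 - z / x) * F z"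
    "\<And>x. x \<in> set xs \<Longrightarrow> x \<noteq> 0 \<and> norm x \<le> R" "\<And>z. norm z \<le> R \<Longrightarrow> F z \<noteq> 0"
    "\<And>z. norm z \<le> 3 * R \<Longrightarrow> norm (F z) \<le> B" "length xs * ln 2 \<le> ln (B / norm (f 0))"
proof -
  define Q where "Q xs F \<longleftrightarrow> F holomorphic_on UNIV \<and> (\<forall>z. f z = (\<Prod>x\<leftarrow>xs. 1 - z / x) * F z)
    \<and> (\<forall>x\<in>set xs. x \<noteq> 0 \<and> norm x \<le> R)" for xs F
  have F0: "F 0 = f 0" if "Q xs F" for xs F
  proof -
    have "(\<Prod>x\<leftarrow>xs. 1) = (1::complex)" by (induction xs) auto
    then show ?thesis using that by (simp add: Q_def)
  qed
  have bound: "norm (F z) * 2 ^ length xs \<le> B" if "Q xs F" "norm z \<le> 3 * R" for xs F z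
    using that R B by (intro norm_factor_le[where f = f and F = F and R = R]) (auto simp: Q_def)
  have len: "length xs * ln 2 \<le> ln (B / norm (f 0))" if "Q xs F" for xs F
  proof -
    have "2 ^ length xs \<le> B / norm (f 0)"
      using bound[OF that, of 0] f R F0[OF that] by (simp add: field_simps)
    then have "ln (2 ^ length xs) \<le> ln (B / norm (f 0))"
      by (smt (verit, best) ln_mono zero_less_power)
    then show ?thesis by (simp add: ln_realpow)
  qed
  have "Q [] f" by (simp add: Q_def f)
  then have 0: "\<exists>F. Q [] F" by blast
  have "\<exists>xs. (\<exists>F. Q xs F) \<and> (\<forall>ys. (\<exists>F. Q ys F) \<longrightarrow> length ys \<le> length xs)"
  proof (rule Lattices_Big.ex_has_greatest_nat[where b = "nat \<lceil>ln (B / norm (f 0)) / ln 2\<rceil> + 1"])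
    show "\<exists>F. Q [] F" by (rule 0)
    show "\<forall>ys. (\<exists>F. Q ys F) \<longrightarrow> length ys < nat \<lceil>ln (B / norm (f 0)) / ln 2\<rceil> + 1"
    proof (intro allI impI)
      fix ys assume "\<exists>F. Q ys F"
      then have "length ys \<le> ln (B / norm (f 0)) / ln 2"
        using len by (auto simp: field_simps)
      then show "length ys < nat \<lceil>ln (B / norm (f 0)) / ln 2\<rceil> + 1" by linarith
    qed
  qed
  then obtain xs F where Q: "Q xs F" and mx: "\<And>ys G. Q ys G \<Longrightarrow> length ys \<le> length xs"
    by blast
  show ?thesis
  proof
    show "F holomorphic_on UNIV" "\<And>z. f z = (\<Prod>x\<leftarrow>xs. 1 - z / x) * F z"
      "\<And>x. x \<in> set xs \<Longrightarrow> x \<noteq> 0 \<and> norm x \<le> R" using Q by (auto simp: Q_def)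
    show "length xs * ln 2 \<le> ln (B / norm (f 0))" by (rule len[OF Q])
    show "norm (F z) \<le> B" if "norm z \<le> 3 * R" for z
      using bound[OF Q that] mult_left_mono[of 1 "2 ^ length xs" "norm (F z)"] by simp
    show "F x \<noteq> 0" if x: "norm x \<le> R" for x
    proof
      assume "F x = 0"
      then have x0: "x \<noteq> 0" using F0[OF Q] f by auto
      obtain G where G: "G holomorphic_on UNIV" "\<And>z. F z = (z - x) * G z"
        using extract_zero[of F x] Q \<open>F x = 0\<close> by (auto simp: Q_def)
      \<comment> \<open>A zero \<open>x\<close> of the cofactor would yield a longer list, because
        \<open>(z - x) * G z = (1 - z / x) * (- x * G z)\<close>.\<close>
      have "Q (x # xs) (\<lambda>z. - x * G z)"
        unfolding Q_def
      proof (intro conjI allI)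
        fix z
        have "(1 - z / x) * (- x * G z) = F z" using x0 by (simp add: G(2) field_simps)
        moreover have "f z = (\<Prod>x\<leftarrow>xs. 1 - z / x) * F z" using Q by (simp add: Q_def)
        moreover have "(\<Prod>x\<leftarrow>x # xs. 1 - z / x) * (- x * G z)
            = (\<Prod>x\<leftarrow>xs. 1 - z / x) * ((1 - z / x) * (- x * G z))"
          by (simp only: list.map prod_list.Cons mult_ac)
        ultimately show "f z = (\<Prod>x\<leftarrow>x # xs. 1 - z / x) * (- x * G z)" by metis
      qed (use Q x x0 in \<open>auto simp: Q_def intro!: holomorphic_intros G(1)\<close>)
      from mx[OF this] show False by simp
    qed
  qed
qed

section \<open>Order less than one and shifts at a single scale\<close>

text \<open>An exponent strictly between the order and 1 bounds the growth far out; on the remaining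
  disc \<open>f\<close> is bounded by compactness, and \<open>K\<close> absorbs that bound.\<close>

lemma growth_order_less_one_bound:
  fixes f :: "complex \<Rightarrow> complex"
  assumes f: "f holomorphic_on UNIV" and ord: "growth_order f < 1"
  obtains \<sigma> K where "0 < \<sigma>" "\<sigma> < 1" "0 \<le> K" "\<And>z. norm (f z) \<le> exp (K * (1 + norm z) powr \<sigma>)"
proof -
  obtain \<tau> where \<tau>: "growth_order f < ereal \<tau>" "\<tau> < 1"
    using ereal_dense2[OF ord] by (metis ereal_less(3))
  \<comment> \<open>The maximum with 1/2 makes the exponent positive, so that \<open>powr\<close> is
    monotone in its base.\<close>
  define \<sigma> where "\<sigma> = max \<tau> (1 / 2)"
  have \<sigma>: "0 < \<sigma>" "\<sigma> < 1" "\<tau> \<le> \<sigma>" using \<tau> by (auto simp: \<sigma>_def)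
  have "\<forall>\<^sub>F r in at_top. ereal (ln_plus (ln_plus (max_modulus f r)) / ln r) < ereal \<tau>"
    using \<tau>(1) unfolding growth_order_def by (rule Limsup_lessD)
  then obtain r0 where r0: "\<And>r. r \<ge> r0 \<Longrightarrow> ln_plus (ln_plus (max_modulus f r)) / ln r < \<tau>"
    by (auto simp: eventually_at_top_linorder)
  define r1 where "r1 = max r0 2"
  have cont: "continuous_on A f" for A
    using f holomorphic_on_imp_continuous_on holomorphic_on_subset by blast
  have lt: "x < exp y" if "ln (max 1 x) < y" for x y :: real
  proof -
    have "max 1 x = exp (ln (max 1 x))" by simp
    also have "\<dots> < exp y" using that by (simp only: exp_less_cancel_iff)
    finally show ?thesis by simp
  qed
  have big: "norm (f z) \<le> exp (norm z powr \<sigma>)" if z: "norm z \<ge> r1" for z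
  proof -
    define r where "r = norm z"
    have r: "r \<ge> r0" "r \<ge> 2" using z by (auto simp: r1_def r_def)
    have "bdd_above ((\<lambda>z. norm (f z)) ` sphere 0 r)"
      by (intro compact_imp_bounded[THEN bounded_imp_bdd_above] compact_continuous_image
          continuous_intros cont) auto
    then have le: "norm (f z) \<le> max_modulus f r"
      unfolding max_modulus_def by (intro cSUP_upper) (auto simp: r_def)
    have "ln_plus (ln_plus (max_modulus f r)) < \<tau> * ln r"
      using r0[OF r(1)] r(2) by (simp add: field_simps)
    also have "\<dots> \<le> \<sigma> * ln r" using \<sigma> r by (intro mult_right_mono) auto
    finally have "ln_plus (max_modulus f r) < exp (\<sigma> * ln r)"
      unfolding ln_plus_def[of "ln_plus _"] by (rule lt)
    then have "ln (max 1 (max_modulus f r)) < r powr \<sigma>"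
      using r by (simp add: powr_def ln_plus_def)
    then have "max_modulus f r < exp (r powr \<sigma>)" by (rule lt)
    then show ?thesis using le by (simp add: r_def)
  qed
  have "bounded (f ` cball 0 r1)"
    by (intro compact_imp_bounded compact_continuous_image cont) auto
  then obtain B where B: "\<And>z. z \<in> cball 0 r1 \<Longrightarrow> norm (f z) \<le> B"
    unfolding bounded_iff by blast
  define K where "K = max 1 (ln (max 1 B))"
  show ?thesis
  proof
    show "norm (f z) \<le> exp (K * (1 + norm z) powr \<sigma>)" for z
    proof (cases "norm z \<ge> r1")
      case True
      have "norm z powr \<sigma> \<le> 1 * (1 + norm z) powr \<sigma>"
        using \<sigma> by (simp add: powr_mono2)
      also have "\<dots> \<le> K * (1 + norm z) powr \<sigma>" by (intro mult_right_mono) (auto simp: K_def)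
      finally show ?thesis using big[OF True] by (meson dual_order.trans exp_le_cancel_iff)
    next
      case False
      then have "norm (f z) \<le> B" by (intro B) auto
      also have "\<dots> \<le> exp (ln (max 1 B))" by simp
      also have "\<dots> \<le> exp (K * 1)" unfolding exp_le_cancel_iff by (simp add: K_def)
      also have "\<dots> \<le> exp (K * (1 + norm z) powr \<sigma>)"
        unfolding exp_le_cancel_iff using \<sigma>
        by (intro mult_left_mono ge_one_powr_ge_zero) (auto simp: K_def)
      finally show ?thesis .
    qed
  qed (use \<sigma> in \<open>auto simp: K_def\<close>)
qed

text \<open>Both \<open>x * y - 1\<close> and \<open>exp (p + q) - 1\<close> expand as a product of
  deviations plus their sum. Deviations bounded by \<open>exp p - 1\<close> thus combine under
  products by adding exponents, which is why the shift estimates are stated in this form.\<close>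

lemma norm_mult_minus_one_le:
  fixes x y :: complex
  assumes "norm (x - 1) \<le> exp p - 1" "norm (y - 1) \<le> exp q - 1"
  shows "norm (x * y - 1) \<le> exp (p + q) - 1"
proof -
  have "norm (x * y - 1) = norm ((x - 1) * (y - 1) + (x - 1) + (y - 1))"
    by (simp add: algebra_simps)
  also have "\<dots> \<le> norm (x - 1) * norm (y - 1) + norm (x - 1) + norm (y - 1)"
    by (metis add_mono norm_mult norm_triangle_ineq norm_triangle_mono order_refl)
  also have "\<dots> \<le> (exp p - 1) * (exp q - 1) + (exp p - 1) + (exp q - 1)"
    using assms order_trans[OF norm_ge_zero assms(1)] by (intro add_mono mult_mono) auto
  finally show ?thesis by (simp add: exp_add algebra_simps)
qed

text \<open>
  The list \<open>xs\<close> collects zeros of \<open>f\<close> as seen from the centre \<open>w\<close>, and \<open>p\<close> accounts for the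
  zero-free cofactor.
\<close>
definition shift_controlled ::
  "(complex \<Rightarrow> complex) \<Rightarrow> complex \<Rightarrow> real \<Rightarrow> real \<Rightarrow> complex list \<Rightarrow> bool" where
  "shift_controlled f w p R xs \<longleftrightarrow> (\<forall>x\<in>set xs. norm x \<le> R) \<and>
    (\<forall>z s. norm (z - w) \<le> R / 4 \<longrightarrow> norm s \<le> R / 8 \<longrightarrow> z - w \<notin> set xs \<longrightarrow> f z \<noteq> 0 \<and>
      norm (f (z + s) / f z - 1) \<le> exp (norm s * (p + (\<Sum>x\<leftarrow>xs. 1 / norm (z - w - x)))) - 1)"

text \<open>At scale \<open>R\<close> the logarithm of the maximum modulus is of size
  \<open>R powr \<sigma>\<close>, which bounds the number of zeros. After these are split off, the
  zero-free cofactor contributes an exponent of size \<open>R powr (\<sigma> - 1)\<close> per unit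
  step, and each zero its reciprocal distance.\<close>

lemma shift_ratio_at_scale:
  fixes f :: "complex \<Rightarrow> complex"
  assumes f: "f holomorphic_on UNIV" "f 0 \<noteq> 0"
    and K: "\<And>z. norm (f z) \<le> exp (K * (1 + norm z) powr \<sigma>)" "0 \<le> K" and \<sigma>: "0 < \<sigma>" "\<sigma> < 1"
  obtains C where "0 \<le> C" "\<And>R. R \<ge> 1 \<Longrightarrow> \<exists>xs. length xs \<le> C * R powr \<sigma> \<and> shift_controlled f 0 (C * R powr (\<sigma> - 1)) R xs"
proof
  \<comment> \<open>The term \<open>4 * K\<close> comes from \<open>1 + 3 * R \<le> 4 * R\<close>
    and \<open>4 powr \<sigma> \<le> 4\<close>; the absolute value covers
    \<open>- ln (norm (f 0))\<close>, as \<open>R powr \<sigma> \<ge> 1\<close>.\<close>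
  define c where "c = 4 * K + \<bar>ln (norm (f 0))\<bar>"
  define C where "C = 16 * (1 + c)"
  have c: "c \<ge> 0" using K by (simp add: c_def)
  then show "0 \<le> C" by (simp add: C_def)
  fix R :: real assume R: "R \<ge> 1"
  define B where "B = exp (K * (1 + 3 * R) powr \<sigma>)"
  have R1: "1 \<le> R powr \<sigma>" using R \<sigma> by (simp add: ge_one_powr_ge_zero)
  have B: "norm (f z) \<le> B" if "norm z \<le> 3 * R" for z
  proof -
    have "norm (f z) \<le> exp (K * (1 + norm z) powr \<sigma>)" by (rule K)
    also have "\<dots> \<le> B" unfolding B_def using that K \<sigma>
      by (auto intro!: mult_left_mono powr_mono2)
    finally show ?thesis .
  qed
  have "(1 + 3 * R) powr \<sigma> \<le> (4 * R) powr \<sigma>" using R \<sigma> by (intro powr_mono2) auto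
  also have "\<dots> = 4 powr \<sigma> * R powr \<sigma>" using R by (simp add: powr_mult)
  also have "\<dots> \<le> 4 * R powr \<sigma>" using powr_mono[of \<sigma> 1 4] \<sigma> by (intro mult_right_mono) auto
  finally have "K * (1 + 3 * R) powr \<sigma> \<le> K * (4 * R powr \<sigma>)" using K by (intro mult_left_mono)
  moreover have "- ln (norm (f 0)) \<le> \<bar>ln (norm (f 0))\<bar> * R powr \<sigma>"
    using mult_left_mono[OF R1, of "\<bar>ln (norm (f 0))\<bar>"] by simp
  ultimately have lnB: "ln (B / norm (f 0)) \<le> c * R powr \<sigma>"
    using f by (simp add: B_def ln_div c_def algebra_simps)
  obtain xs F where F: "F holomorphic_on UNIV" "\<And>z. f z = (\<Prod>x\<leftarrow>xs. 1 - z / x) * F z"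
    and xs: "\<And>x. x \<in> set xs \<Longrightarrow> x \<noteq> 0 \<and> norm x \<le> R" and F0: "\<And>z. norm z \<le> R \<Longrightarrow> F z \<noteq> 0"
    and FB: "\<And>z. norm z \<le> 3 * R \<Longrightarrow> norm (F z) \<le> B" and len: "length xs * ln 2 \<le> ln (B / norm (f 0))"
    by (rule zero_factorization[where R = R and B = B, OF f]) (use B R in auto)
  have "(\<Prod>x\<leftarrow>xs. 1) = (1::complex)" by (induction xs) auto
  then have Ff: "F 0 = f 0" by (simp add: F(2))
  have "length xs * (1 / 2) \<le> length xs * ln (2::real)"
    using ln2_ge_two_thirds by (intro mult_left_mono) auto
  then have "length xs \<le> 2 * (c * R powr \<sigma>)" using len lnB by simp
  also have "\<dots> \<le> C * R powr \<sigma>" using c by (simp add: C_def algebra_simps)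
  finally have l: "length xs \<le> C * R powr \<sigma>" .
  have main: "f z \<noteq> 0 \<and> norm (f (z + s) / f z - 1)
      \<le> exp (norm s * (C * R powr (\<sigma> - 1) + (\<Sum>x\<leftarrow>xs. 1 / norm (z - x)))) - 1"
    if z: "norm z \<le> R / 4" "z \<notin> set xs" and s: "norm s \<le> R / 8" for z s
  proof -
    have prod: "(\<Prod>x\<leftarrow>xs. 1 - z / x) \<noteq> 0 \<and>
       norm ((\<Prod>x\<leftarrow>xs. 1 - (z + s) / x) / (\<Prod>x\<leftarrow>xs. 1 - z / x) - 1) \<le> exp (\<Sum>x\<leftarrow>xs. norm s / norm (z - x)) - 1"
      using xs z(2)
    proof (induction xs)
      case (Cons x xs)
      have x: "x \<noteq> 0" "z \<noteq> x" using Cons.prems by auto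
      \<comment> \<open>The ratio of one linear factor deviates from 1 by exactly
        \<open>s / (z - x)\<close>, the source of the reciprocal distances.\<close>
      have "(1 - (z + s) / x) / (1 - z / x) - 1 = s / (z - x)"
        using x by (simp add: field_simps) 
      then have "norm ((1 - (z + s) / x) / (1 - z / x) - 1) = norm s / norm (z - x)"
        by (simp add: norm_divide)
      also have "\<dots> \<le> exp (norm s / norm (z - x)) - 1"
        using exp_ge_add_one_self[of "norm s / norm (z - x)"] by linarith
      finally have "norm ((1 - (z + s) / x) / (1 - z / x) - 1) \<le> exp (norm s / norm (z - x)) - 1" .
      moreover have ih: "(\<Prod>x\<leftarrow>xs. 1 - z / x) \<noteq> 0 \<and>
         norm ((\<Prod>x\<leftarrow>xs. 1 - (z + s) / x) / (\<Prod>x\<leftarrow>xs. 1 - z / x) - 1) \<le> exp (\<Sum>x\<leftarrow>xs. norm s / norm (z - x)) - 1"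
        using Cons by auto
      ultimately have "norm ((1 - (z + s) / x) / (1 - z / x) * ((\<Prod>x\<leftarrow>xs. 1 - (z + s) / x) / (\<Prod>x\<leftarrow>xs. 1 - z / x)) - 1)
          \<le> exp (norm s / norm (z - x) + (\<Sum>x\<leftarrow>xs. norm s / norm (z - x))) - 1"
        by (intro norm_mult_minus_one_le) auto
      moreover have "1 - z / x \<noteq> 0" using x by (simp add: field_simps)
      ultimately show ?case using ih by (simp only: times_divide_times_eq list.map prod_list.Cons sum_list.Cons) simp
    qed simp
    have "norm (F (z + s) / F z - 1) \<le> exp (16 * (1 + ln (B / norm (F 0))) * norm s / R) - 1"
      by (rule zero_free_shift_ratio) (use F(1) F0 FB R z s holomorphic_on_subset in auto)
    also have "16 * (1 + ln (B / norm (F 0))) * norm s / R \<le> 16 * (R powr \<sigma> + c * R powr \<sigma>) * norm s / R"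
      using lnB R1 R by (intro divide_right_mono mult_right_mono mult_left_mono add_mono) (auto simp: Ff)
    also have "\<dots> = norm s * (C * R powr (\<sigma> - 1))"
      using R by (simp add: C_def powr_diff algebra_simps add_divide_distrib)
    finally have Fr: "norm (F (z + s) / F z - 1) \<le> exp (norm s * (C * R powr (\<sigma> - 1))) - 1" by simp
    have "(\<Sum>x\<leftarrow>xs. norm s / norm (z - x)) = norm s * (\<Sum>x\<leftarrow>xs. 1 / norm (z - x))"
      by (simp flip: sum_list_const_mult)
    with norm_mult_minus_one_le[OF Fr conjunct2[OF prod]] show ?thesis
      using prod F0[of z] z R by (simp add: F(2) algebra_simps)
  qed
  show "\<exists>xs. length xs \<le> C * R powr \<sigma> \<and> shift_controlled f 0 (C * R powr (\<sigma> - 1)) R xs"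
    using l xs main unfolding shift_controlled_def by (intro exI[of _ xs]) simp
qed

section \<open>Circles that keep away from all zeros\<close>

text \<open>Here \<open>g\<close> will be a distance rounded down to an integer: distinct integers
  in \<open>1..n\<close> select distinct terms of the harmonic sum.\<close>

lemma sum_inverse_shifted_le_harm:
  fixes A :: "nat set"
  assumes "inj_on g A" "\<And>r. r \<in> A \<Longrightarrow> 1 \<le> g r \<and> g r \<le> n \<and> h r \<le> 1 / real (g r)"
  shows "(\<Sum>r\<in>A. h r) \<le> harm n"
proof -
  have "(\<Sum>r\<in>A. h r) \<le> (\<Sum>r\<in>A. 1 / real (g r))" using assms by (intro sum_mono) auto
  also have "\<dots> = (\<Sum>k\<in>g ` A. 1 / real k)" using assms(1) by (simp add: sum.reindex)
  also have "\<dots> \<le> (\<Sum>k=1..n. 1 / real k)" using assms by (intro sum_mono2) auto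
  finally show ?thesis by (simp add: harm_def inverse_eq_divide)
qed

text \<open>Average over the \<open>N\<close> integer radii. For fixed \<open>y\<close> at most two
  radii are closer than 1, costing \<open>2 * T\<close>, and the radii on either side cost at most
  one harmonic sum \<open>T\<close> each. Some radius is no worse than the average
  \<open>4 * length ys * T / N\<close>.\<close>

lemma separated_radius:
  fixes ys :: "real list"
  assumes ys: "\<And>y. y \<in> set ys \<Longrightarrow> 0 \<le> y \<and> y \<le> real (8 * N)" and len: "4 * length ys < N"
  obtains r where "N \<le> r" "r < 2 * N" "\<And>y. y \<in> set ys \<Longrightarrow> 1 \<le> \<bar>real r - y\<bar>"
    "(\<Sum>y\<leftarrow>ys. 1 / \<bar>real r - y\<bar>) \<le> 4 * length ys * harm (8 * N) / N"
proof -
  define T :: real where "T = harm (8 * N)"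
  \<comment> \<open>With the penalty \<open>T\<close> near \<open>0\<close>, one averaging yields both the separation and the sum bound.\<close>
  define \<phi> where "\<phi> t = (if \<bar>t\<bar> < 1 then T else 1 / \<bar>t\<bar>)" for t :: real
  have N: "N > 0" using len by simp
  have T: "T > 0" using N by (simp add: T_def harm_pos)
  have \<phi>0: "\<phi> t \<ge> 0" for t using T by (simp add: \<phi>_def)
  have one: "(\<Sum>r\<in>{N..<2*N}. \<phi> (real r - y)) \<le> 4 * T" if y: "0 \<le> y" "y \<le> real (8 * N)" for y
  proof -
    define I where "I = {N..<2*N}"
    define I0 where "I0 = {r \<in> I. \<bar>real r - y\<bar> < 1}"
    define I1 where "I1 = {r \<in> I. real r - y \<ge> 1}"
    define I2 where "I2 = {r \<in> I. y - real r \<ge> 1}"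
    have fin: "finite I0" "finite I1" "finite I2" by (auto simp: I_def I0_def I1_def I2_def)
    have I: "I = I0 \<union> I1 \<union> I2" by (auto simp: I0_def I1_def I2_def)
    have "I0 \<subseteq> {nat \<lfloor>y\<rfloor>, nat \<lfloor>y\<rfloor> + 1}"
    proof
      fix r assume "r \<in> I0"
      then have "\<bar>real r - y\<bar> < 1" by (simp add: I0_def)
      then show "r \<in> {nat \<lfloor>y\<rfloor>, nat \<lfloor>y\<rfloor> + 1}" using y(1) by simp linarith
    qed
    then have "card I0 \<le> card {nat \<lfloor>y\<rfloor>, nat \<lfloor>y\<rfloor> + 1}" by (intro card_mono) auto
    then have c0: "card I0 \<le> 2" by simp
    have "(\<Sum>r\<in>I0. \<phi> (real r - y)) = card I0 * T" by (simp add: I0_def \<phi>_def)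
    also have "\<dots> \<le> 2 * T" using c0 T by (intro mult_right_mono) auto
    finally have s0: "(\<Sum>r\<in>I0. \<phi> (real r - y)) \<le> 2 * T" .
    have s1: "(\<Sum>r\<in>I1. \<phi> (real r - y)) \<le> T" unfolding T_def
    \<comment> \<open>Measuring from the ceiling of \<open>y\<close> here, and from its floor for
      \<open>I2\<close>, rounds the distances down while keeping them distinct and at least
      1.\<close>
    proof (rule sum_inverse_shifted_le_harm[where g = "\<lambda>r. r - nat \<lceil>y\<rceil>"])
      have *: "nat \<lceil>y\<rceil> < r" if "r \<in> I1" for r
        using that y(1) unfolding I1_def by simp linarith
      show "inj_on (\<lambda>r. r - nat \<lceil>y\<rceil>) I1" using * by (intro inj_onI) (metis diff_add less_imp_le le_add_diff_inverse2)
      fix r assume r: "r \<in> I1"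
      have "real (r - nat \<lceil>y\<rceil>) \<le> real r - y" using *[OF r] real_nat_ceiling_ge[of y] by (simp add: of_nat_diff)
      moreover have "0 < real (r - nat \<lceil>y\<rceil>)" using *[OF r] by simp
      moreover have "r \<le> 8 * N" using r by (auto simp: I1_def I_def)
      ultimately show "1 \<le> r - nat \<lceil>y\<rceil> \<and> r - nat \<lceil>y\<rceil> \<le> 8 * N \<and> \<phi> (real r - y) \<le> 1 / real (r - nat \<lceil>y\<rceil>)"
        using *[OF r] r by (auto simp: \<phi>_def I1_def intro!: divide_left_mono mult_pos_pos)
    qed
    have s2: "(\<Sum>r\<in>I2. \<phi> (real r - y)) \<le> T" unfolding T_def
    proof (rule sum_inverse_shifted_le_harm[where g = "\<lambda>r. nat \<lfloor>y\<rfloor> - r"])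
      have *: "r < nat \<lfloor>y\<rfloor>" if "r \<in> I2" for r
        using that y(1) unfolding I2_def by simp linarith
      show "inj_on (\<lambda>r. nat \<lfloor>y\<rfloor> - r) I2" using * by (intro inj_onI) (metis diff_diff_cancel less_imp_le)
      fix r assume r: "r \<in> I2"
      have "real (nat \<lfloor>y\<rfloor> - r) \<le> y - real r" using *[OF r] of_nat_floor[OF y(1)] by (simp add: of_nat_diff)
      moreover have "0 < real (nat \<lfloor>y\<rfloor> - r)" using *[OF r] by simp
      moreover have "nat \<lfloor>y\<rfloor> \<le> 8 * N" using y by linarith
      ultimately show "1 \<le> nat \<lfloor>y\<rfloor> - r \<and> nat \<lfloor>y\<rfloor> - r \<le> 8 * N \<and> \<phi> (real r - y) \<le> 1 / real (nat \<lfloor>y\<rfloor> - r)"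
        using *[OF r] r by (auto simp: \<phi>_def I2_def intro!: divide_left_mono mult_pos_pos)
    qed
    have "I0 \<inter> I1 = {}" "(I0 \<union> I1) \<inter> I2 = {}" by (auto simp: I0_def I1_def I2_def)
    then have "(\<Sum>r\<in>I. \<phi> (real r - y)) = (\<Sum>r\<in>I0. \<phi> (real r - y)) + (\<Sum>r\<in>I1. \<phi> (real r - y)) + (\<Sum>r\<in>I2. \<phi> (real r - y))"
      unfolding I using fin by (simp add: sum.union_disjoint)
    then show ?thesis using s0 s1 s2 by (simp add: I_def)
  qed
  have "(\<Sum>r\<in>{N..<2*N}. \<Sum>y\<leftarrow>ys. \<phi> (real r - y)) \<le> length ys * (4 * T)"
    using ys
  proof (induction ys)
    case (Cons y ys)
    have "(\<Sum>r\<in>{N..<2*N}. \<phi> (real r - y)) \<le> 4 * T" using Cons.prems by (intro one) auto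
    moreover have "(\<Sum>r\<in>{N..<2*N}. \<Sum>y\<leftarrow>ys. \<phi> (real r - y)) \<le> length ys * (4 * T)"
      using Cons by auto
    ultimately show ?case by (simp add: sum.distrib algebra_simps)
  qed simp
  also have "\<dots> = (\<Sum>r\<in>{N..<2*N}. length ys * (4 * T) / N)" using N by simp
  finally have le: "(\<Sum>r\<in>{N..<2*N}. \<Sum>y\<leftarrow>ys. \<phi> (real r - y)) \<le> (\<Sum>r\<in>{N..<2*N}. length ys * (4 * T) / N)" .
  have "\<exists>r\<in>{N..<2*N}. (\<Sum>y\<leftarrow>ys. \<phi> (real r - y)) \<le> length ys * (4 * T) / N"
  proof (rule ccontr)
    assume "\<not> ?thesis"
    then have "(\<Sum>r\<in>{N..<2*N}. length ys * (4 * T) / N) < (\<Sum>r\<in>{N..<2*N}. \<Sum>y\<leftarrow>ys. \<phi> (real r - y))"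
      using N by (intro sum_strict_mono) (auto simp: not_le)
    with le show False by simp
  qed
  then obtain r where r: "r \<in> {N..<2*N}" "(\<Sum>y\<leftarrow>ys. \<phi> (real r - y)) \<le> length ys * (4 * T) / N" by blast
  \<comment> \<open>The average is below \<open>T\<close>, the penalty of a single \<open>y\<close>
    closer than 1; all terms being nonnegative, the chosen \<open>r\<close> has no such
    \<open>y\<close>.\<close>
  have "real (4 * length ys) < real N" using len by (simp only: of_nat_less_iff)
  then have "length ys * (4 * T) / N < T" using N T by (simp add: field_simps)
  then have lt: "(\<Sum>y\<leftarrow>ys. \<phi> (real r - y)) < T" using r(2) by simp
  have mem: "\<phi> (real r - y) \<le> (\<Sum>y\<leftarrow>zs. \<phi> (real r - y))" if "y \<in> set zs" for y zs
    using that
  proof (induction zs)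
    case (Cons z zs)
    have "0 \<le> (\<Sum>y\<leftarrow>zs. \<phi> (real r - y))" using \<phi>0 by (intro sum_list_nonneg) auto
    then show ?case using Cons \<phi>0[of "real r - z"] by force
  qed simp
  have sep: "1 \<le> \<bar>real r - y\<bar>" if "y \<in> set ys" for y
    using mem[OF that] lt by (auto simp: \<phi>_def split: if_splits)
  have "\<phi> (real r - y) = 1 / \<bar>real r - y\<bar>" if "y \<in> set ys" for y
    using sep[OF that] by (simp add: \<phi>_def)
  then have "map (\<lambda>y. \<phi> (real r - y)) ys = map (\<lambda>y. 1 / \<bar>real r - y\<bar>) ys" by (intro map_cong refl)
  then have eq: "(\<Sum>y\<leftarrow>ys. \<phi> (real r - y)) = (\<Sum>y\<leftarrow>ys. 1 / \<bar>real r - y\<bar>)" by (rule arg_cong)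
  show ?thesis
    by (rule that[of r]) (use r sep eq in \<open>auto simp: T_def mult_ac\<close>)
qed

lemma harm_le_one_plus_ln:
  assumes "n \<ge> 1"
  shows "(harm n :: real) \<le> 1 + ln (real n)"
proof -
  have "harm (Suc (n - 1)) - ln (real (Suc (n - 1))) \<le> harm (Suc 0) - ln (real (Suc 0))"
    using decseq_harm_diff_ln unfolding decseq_def by blast
  then show ?thesis using assms by (simp add: harm_Suc harm_def)
qed

text \<open>Counting zeros requires a nonzero value at the centre, so the estimate is moved from 0
  to \<open>w\<close>. The growth bound survives because
  \<open>1 + norm (w + z) \<le> (1 + norm w) * (1 + norm z)\<close>.\<close>

lemma exists_scale_constants:
  fixes f :: "complex \<Rightarrow> complex"
  assumes f: "f holomorphic_on UNIV" "growth_order f < 1" "f w \<noteq> 0"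
  shows "\<exists>C \<sigma>. 0 \<le> C \<and> 0 < \<sigma> \<and> \<sigma> < 1 \<and>
    (\<forall>R\<ge>1. \<exists>xs. length xs \<le> C * R powr \<sigma> \<and> shift_controlled f w (C * R powr (\<sigma> - 1)) R xs)"
proof -
  obtain \<sigma> K where \<sigma>: "0 < \<sigma>" "\<sigma> < 1" and K: "0 \<le> K" "\<And>z. norm (f z) \<le> exp (K * (1 + norm z) powr \<sigma>)"
    using growth_order_less_one_bound[OF f(1,2)] by blast
  define g where "g z = f (w + z)" for z
  have "(f \<circ> (\<lambda>z. w + z)) holomorphic_on UNIV"
    by (intro holomorphic_on_compose_gen[OF _ f(1)] holomorphic_intros) auto
  then have g: "g holomorphic_on UNIV" "g 0 \<noteq> 0"
    using f(3) by (simp_all add: g_def[abs_def] o_def)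
  have gb: "norm (g z) \<le> exp (K * (1 + norm w) powr \<sigma> * (1 + norm z) powr \<sigma>)" for z
  proof -
    have "(1 + norm (w + z)) \<le> (1 + norm w) * (1 + norm z)"
      using norm_triangle_ineq[of w z] mult_nonneg_nonneg[OF norm_ge_zero[of w] norm_ge_zero[of z]]
      unfolding ring_distribs by linarith
    then have "(1 + norm (w + z)) powr \<sigma> \<le> ((1 + norm w) * (1 + norm z)) powr \<sigma>"
      using \<sigma> by (intro powr_mono2) auto
    also have "\<dots> = (1 + norm w) powr \<sigma> * (1 + norm z) powr \<sigma>" by (simp add: powr_mult)
    finally have "K * (1 + norm (w + z)) powr \<sigma> \<le> K * ((1 + norm w) powr \<sigma> * (1 + norm z) powr \<sigma>)"
      using K by (intro mult_left_mono)
    then show ?thesis using order_trans[OF K(2)[of "w + z"]] by (simp add: g_def mult.assoc)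
  qed
  obtain C where C: "0 \<le> C"
    "\<And>R. R \<ge> 1 \<Longrightarrow> \<exists>xs. length xs \<le> C * R powr \<sigma> \<and> shift_controlled g 0 (C * R powr (\<sigma> - 1)) R xs"
    by (rule shift_ratio_at_scale[OF g gb _ \<sigma>]) (use K in auto)
  have tr: "shift_controlled f w p R xs" if "shift_controlled g 0 p R xs" for p R xs
    unfolding shift_controlled_def
  proof (intro conjI)
    show "\<forall>x\<in>set xs. norm x \<le> R" using that by (simp add: shift_controlled_def)
    have "\<And>z s. norm z \<le> R / 4 \<Longrightarrow> norm s \<le> R / 8 \<Longrightarrow> z \<notin> set xs \<Longrightarrow> f (w + z) \<noteq> 0 \<and>
      norm (f (w + (z + s)) / f (w + z) - 1) \<le> exp (norm s * (p + (\<Sum>x\<leftarrow>xs. 1 / norm (z - x)))) - 1"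
      using that by (simp add: shift_controlled_def g_def)
    from this[of "z - w" s for z s] show "\<forall>z s. norm (z - w) \<le> R / 4 \<longrightarrow> norm s \<le> R / 8 \<longrightarrow> z - w \<notin> set xs \<longrightarrow> f z \<noteq> 0 \<and>
      norm (f (z + s) / f z - 1) \<le> exp (norm s * (p + (\<Sum>x\<leftarrow>xs. 1 / norm (z - w - x)))) - 1"
      by (simp add: algebra_simps)
  qed
  show ?thesis using C \<sigma> tr by meson
qed

text \<open>The moduli of the zeros of all members of \<open>A\<close>, seen from \<open>w\<close>,
  are pooled into one list, so that one radius serves every function. Since all exponents are below
  1, the zero counts divided by the scale tend to 0 even after multiplication by the logarithm from
  the harmonic sum.\<close>

lemma shift_ratio_near_one:
  fixes A :: "(complex \<Rightarrow> complex) set"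
  assumes fin: "finite A" and \<epsilon>: "\<epsilon> > 0"
    and A: "\<And>f. f \<in> A \<Longrightarrow> f holomorphic_on UNIV \<and> growth_order f < 1 \<and> f w \<noteq> 0"
  obtains r where "r > R0" "\<And>f z. f \<in> A \<Longrightarrow> norm (z - w) = r \<Longrightarrow> f z \<noteq> 0"
    "\<And>f z s. f \<in> A \<Longrightarrow> norm (z - w) = r \<Longrightarrow> norm s \<le> S \<Longrightarrow> norm (f (z + s) / f z - 1) \<le> \<epsilon>"
proof -
  obtain fs where fs: "set fs = A" "distinct fs" using finite_distinct_list[OF fin] by blast
  have "\<forall>f\<in>A. \<exists>C \<sigma>. 0 \<le> C \<and> 0 < \<sigma> \<and> \<sigma> < 1 \<and>
    (\<forall>R\<ge>1. \<exists>xs. length xs \<le> C * R powr \<sigma> \<and> shift_controlled f w (C * R powr (\<sigma> - 1)) R xs)"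
    using exists_scale_constants A by simp
  then obtain C \<sigma> where C: "\<And>f. f \<in> A \<Longrightarrow> 0 \<le> C f" and \<sigma>: "\<And>f. f \<in> A \<Longrightarrow> 0 < \<sigma> f \<and> \<sigma> f < 1"
    and X: "\<And>f R. f \<in> A \<Longrightarrow> R \<ge> 1 \<Longrightarrow>
      \<exists>xs. length xs \<le> C f * R powr \<sigma> f \<and> shift_controlled f w (C f * R powr (\<sigma> f - 1)) R xs"
    by metis
  \<comment> \<open>\<open>L N\<close> bounds the cofactor exponent and \<open>32 * L N\<close> the
    sum of reciprocal distances, hence \<open>33 * L N\<close> in total. The condition
    \<open>L N < 1 / 32\<close> makes the list short enough for
    \<open>separated_radius\<close>.\<close>
  define L where "L N = (\<Sum>f\<in>A. C f * ((8 * real N) powr (\<sigma> f - 1) * (1 + ln (8 * real N))))" for N :: nat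
  have "(\<lambda>N::nat. (8 * real N) powr (\<sigma> f - 1) * (1 + ln (8 * real N))) \<longlonglongrightarrow> 0" if "f \<in> A" for f
  proof -
    have "(\<lambda>N::nat. (8 * real N) powr e * (1 + ln (8 * real N))) \<longlonglongrightarrow> 0" if "e < 0" for e :: real
      using that by real_asymp
    then show ?thesis using \<sigma>[OF that] by simp
  qed
  then have L0: "L \<longlonglongrightarrow> 0" unfolding L_def
    by (intro tendsto_null_sum tendsto_mult_right_zero) auto
  then have "(\<lambda>N. \<bar>S\<bar> * 33 * L N) \<longlonglongrightarrow> 0" by (intro tendsto_mult_right_zero)
  moreover have "0 < ln (1 + \<epsilon>)" using \<epsilon> by simp
  ultimately have "\<forall>\<^sub>F N in sequentially. \<bar>S\<bar> * 33 * L N < ln (1 + \<epsilon>)" by (rule order_tendstoD)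
  moreover have "\<forall>\<^sub>F N in sequentially. L N < 1 / 32" using L0 by (rule order_tendstoD) simp
  moreover have "\<forall>\<^sub>F N in sequentially. N > nat \<lceil>\<bar>S\<bar>\<rceil> + nat \<lceil>\<bar>R0\<bar>\<rceil>" by (rule eventually_gt_at_top)
  ultimately have "\<forall>\<^sub>F N in sequentially. \<bar>S\<bar> * 33 * L N < ln (1 + \<epsilon>) \<and> L N < 1 / 32 \<and> N > nat \<lceil>\<bar>S\<bar>\<rceil> + nat \<lceil>\<bar>R0\<bar>\<rceil>"
    by (intro eventually_conj)
  then obtain N where N: "\<bar>S\<bar> * 33 * L N < ln (1 + \<epsilon>)" "L N < 1 / 32" "N > nat \<lceil>\<bar>S\<bar>\<rceil> + nat \<lceil>\<bar>R0\<bar>\<rceil>"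
    using eventually_happens'[OF sequentially_bot] by blast
  have NS: "\<bar>S\<bar> \<le> N" "R0 < N" "N \<ge> 1" using N(3) by linarith+
  \<comment> \<open>With this scale \<open>r < 2 * N\<close> gives radius at most
    \<open>R / 4\<close>, and \<open>\<bar>S\<bar> \<le> N\<close> gives steps at most
    \<open>R / 8\<close>, the ranges in \<open>shift_controlled\<close>.\<close>
  define R where "R = 8 * real N"
  have R: "R \<ge> 1" using NS by (simp add: R_def)
  have lnR: "ln R \<ge> 0" using R by simp
  have tm: "0 \<le> C f * (R powr (\<sigma> f - 1) * (1 + ln R))" if "f \<in> A" for f
    using C[OF that] lnR by simp
  have CL: "C f * R powr (\<sigma> f - 1) \<le> L N" if "f \<in> A" for f
  proof -
    have "C f * (R powr (\<sigma> f - 1) * 1) \<le> C f * (R powr (\<sigma> f - 1) * (1 + ln R))"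
      using C[OF that] lnR by (intro mult_left_mono) auto
    also have "\<dots> \<le> L N" unfolding L_def R_def[symmetric]
      using fin that tm by (intro member_le_sum) auto
    finally show ?thesis by simp
  qed
  have "\<forall>f\<in>A. \<exists>xs. length xs \<le> C f * R powr \<sigma> f \<and> shift_controlled f w (C f * R powr (\<sigma> f - 1)) R xs"
    using X R by blast
  then obtain xs where len: "\<And>f. f \<in> A \<Longrightarrow> length (xs f) \<le> C f * R powr \<sigma> f"
    and sc: "\<And>f. f \<in> A \<Longrightarrow> shift_controlled f w (C f * R powr (\<sigma> f - 1)) R (xs f)"
    by metis
  have xR: "\<And>f x. f \<in> A \<Longrightarrow> x \<in> set (xs f) \<Longrightarrow> norm x \<le> R"
    and xs: "\<And>f z s. f \<in> A \<Longrightarrow> norm (z - w) \<le> R / 4 \<Longrightarrow> norm s \<le> R / 8 \<Longrightarrow> z - w \<notin> set (xs f) \<Longrightarrow> f z \<noteq> 0 \<and>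
      norm (f (z + s) / f z - 1) \<le> exp (norm s * (C f * R powr (\<sigma> f - 1) + (\<Sum>x\<leftarrow>xs f. 1 / norm (z - w - x)))) - 1"
    using sc unfolding shift_controlled_def by auto
  define ys where "ys = concat (map (\<lambda>f. map norm (xs f)) fs)"
  have "real (length ys) = (\<Sum>f\<in>A. real (length (xs f)))"
    using fs by (simp add: ys_def length_concat comp_def sum_list_distinct_conv_sum_set of_nat_sum)
  also have "\<dots> * (1 + ln R) \<le> (\<Sum>f\<in>A. C f * R powr \<sigma> f) * (1 + ln R)"
    using len lnR by (intro mult_right_mono sum_mono) auto
  also have "\<dots> = (\<Sum>f\<in>A. R * (C f * (R powr (\<sigma> f - 1) * (1 + ln R))))"
    unfolding sum_distrib_right using R by (intro sum.cong) (auto simp: powr_diff)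
  also have "\<dots> = 8 * real N * L N"
    by (simp add: L_def R_def sum_distrib_left)
  finally have lenL: "real (length ys) * (1 + ln R) \<le> 8 * real N * L N" .
  have "4 * real (length ys) \<le> 4 * (real (length ys) * (1 + ln R))"
    using lnR by (simp add: algebra_simps)
  also have "\<dots> \<le> 32 * L N * real N" using mult_left_mono[OF lenL, of 4] by (simp add: mult_ac)
  also have "\<dots> < 1 * real N" using N(2) NS by (intro mult_strict_right_mono) auto
  finally have "4 * length ys < N" by linarith
  moreover have "0 \<le> y \<and> y \<le> real (8 * N)" if "y \<in> set ys" for y
    using that xR fs by (auto simp: ys_def R_def)
  ultimately obtain r where r: "N \<le> r" "r < 2 * N" and sep: "\<And>y. y \<in> set ys \<Longrightarrow> 1 \<le> \<bar>real r - y\<bar>"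
    and sum: "(\<Sum>y\<leftarrow>ys. 1 / \<bar>real r - y\<bar>) \<le> 4 * length ys * harm (8 * N) / N"
    by - (rule separated_radius[where N = N and ys = ys], auto)
  have "4 * real (length ys) * harm (8 * N) / N \<le> 4 * real (length ys) * (1 + ln R) / N"
    using harm_le_one_plus_ln[of "8 * N"] NS by (intro divide_right_mono mult_left_mono) (auto simp: R_def)
  also have "\<dots> \<le> 32 * L N" using mult_left_mono[OF lenL, of 4] NS by (simp add: pos_divide_le_eq mult_ac)
  finally have sumL: "(\<Sum>y\<leftarrow>ys. 1 / \<bar>real r - y\<bar>) \<le> 32 * L N" using sum by simp
  have sub: "(\<Sum>y\<leftarrow>map norm (xs f). 1 / \<bar>real r - y\<bar>) \<le> (\<Sum>y\<leftarrow>concat (map (\<lambda>f. map norm (xs f)) gs). 1 / \<bar>real r - y\<bar>)"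
    if "f \<in> set gs" for f gs
    using that
  proof (induction gs)
    case (Cons g gs)
    have nn: "0 \<le> (\<Sum>y\<leftarrow>zs. 1 / \<bar>real r - y\<bar>)" for zs by (rule sum_list_nonneg) auto
    show ?case using Cons nn[of "map norm (xs g)"] nn[of "concat (map (\<lambda>f. map norm (xs f)) gs)"]
      by (auto simp: comp_def)
  qed simp
  have key: "f z \<noteq> 0 \<and> (norm s \<le> \<bar>S\<bar> \<longrightarrow> norm (f (z + s) / f z - 1) \<le> \<epsilon>)"
    if f: "f \<in> A" and z: "norm (z - w) = real r" for f z s
  proof -
    have dist: "\<bar>real r - norm x\<bar> \<le> norm (z - w - x)" for x
      using norm_triangle_ineq3[of "z - w" x] z by simp
    have sep': "1 \<le> \<bar>real r - norm x\<bar>" if "x \<in> set (xs f)" for x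
      using that f fs by (intro sep) (auto simp: ys_def)
    have notin: "z - w \<notin> set (xs f)" using sep'[of "z - w"] z by auto
    have zR: "norm (z - w) \<le> R / 4" using z r by (simp add: R_def)
    have "f z \<noteq> 0" using xs[OF f zR _ notin, of 0] R by simp
    moreover have "norm (f (z + s) / f z - 1) \<le> \<epsilon>" if s: "norm s \<le> \<bar>S\<bar>"
    proof -
      have sR: "norm s \<le> R / 8" using s NS by (simp add: R_def)
      have "(\<Sum>x\<leftarrow>xs f. 1 / norm (z - w - x)) \<le> (\<Sum>x\<leftarrow>xs f. 1 / \<bar>real r - norm x\<bar>)"
      proof (rule sum_list_mono)
        fix x assume "x \<in> set (xs f)"
        then have "0 < \<bar>real r - norm x\<bar>" using sep'[of x] by linarith
        then show "1 / norm (z - w - x) \<le> 1 / \<bar>real r - norm x\<bar>" using dist[of x] by (simp add: frac_le)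
      qed
      also have "\<dots> \<le> 32 * L N"
        using sub[of f fs] sumL f fs by (simp add: ys_def comp_def)
      finally have "C f * R powr (\<sigma> f - 1) + (\<Sum>x\<leftarrow>xs f. 1 / norm (z - w - x)) \<le> 33 * L N"
        using CL[OF f] by simp
      moreover have "0 \<le> 33 * L N"
        using order_trans[OF mult_nonneg_nonneg[OF C[OF f] powr_ge_zero] CL[OF f]] by simp
      ultimately have "norm s * (C f * R powr (\<sigma> f - 1) + (\<Sum>x\<leftarrow>xs f. 1 / norm (z - w - x))) \<le> \<bar>S\<bar> * (33 * L N)"
        using s by (meson mult_left_mono mult_right_mono norm_ge_zero order_trans)
      also have "\<dots> < ln (1 + \<epsilon>)" using N(1) by simp
      finally have "exp (norm s * (C f * R powr (\<sigma> f - 1) + (\<Sum>x\<leftarrow>xs f. 1 / norm (z - w - x)))) < exp (ln (1 + \<epsilon>))"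
        by (simp only: exp_less_cancel_iff)
      then show ?thesis using xs[OF f zR sR notin] \<epsilon> by simp
    qed
    ultimately show ?thesis by blast
  qed
  show ?thesis
  proof (rule that[of "real r"])
    show "R0 < real r" using NS r by linarith
  qed (use key in force)+
qed

section \<open>Falling powers and shifting divisors\<close>

lemma holomorphic_shift:
  fixes f :: "complex \<Rightarrow> complex"
  assumes "f holomorphic_on UNIV"
  shows "(\<lambda>z. f (z + s)) holomorphic_on UNIV" "(\<lambda>z. f (z - s)) holomorphic_on UNIV"
proof -
  have "(f \<circ> (\<lambda>z. z + t)) holomorphic_on UNIV" for t
    by (intro holomorphic_on_compose_gen[OF _ assms] holomorphic_intros) auto
  from this[of s] this[of "- s"]
  show "(\<lambda>z. f (z + s)) holomorphic_on UNIV" "(\<lambda>z. f (z - s)) holomorphic_on UNIV"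
    by (simp_all add: o_def)
qed

lemma holomorphic_falling_power:
  assumes "f holomorphic_on UNIV"
  shows "falling_power f n holomorphic_on UNIV"
  unfolding falling_power_def[abs_def] by (intro holomorphic_intros holomorphic_shift assms)

lemma falling_power_Suc: "falling_power f (Suc m) z = falling_power f m z * f (z - of_nat m)"
  by (simp add: falling_power_def)

text \<open>Together with \<open>falling_power_Suc\<close> this shows that the values at
  \<open>z\<close> and \<open>z + 1\<close> share the factor \<open>falling_power f m z\<close>, and
  differ only in one end factor.\<close>

lemma falling_power_Suc_shift: "falling_power f (Suc m) (z + 1) = f (z + 1) * falling_power f m z"
  unfolding falling_power_def prod.lessThan_Suc_shift by (simp add: algebra_simps)

section \<open>Vanishing, divisibility and zeros of finite length\<close>

text \<open>Zero sets of nontrivial entire functions are countable, the plane is not. The point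
  \<open>w\<close> will be the common centre of the circles.\<close>

lemma common_nonzero:
  fixes A :: "(complex \<Rightarrow> complex) set"
  assumes "finite A" "\<And>f. f \<in> A \<Longrightarrow> f holomorphic_on UNIV \<and> (\<exists>z. f z \<noteq> 0)"
  obtains w where "\<And>f. f \<in> A \<Longrightarrow> f w \<noteq> 0"
proof -
  have "countable {z. f z = 0}" if f: "f \<in> A" for f
  proof (cases "f constant_on UNIV")
    case True
    then have "{z. f z = 0} = {}" using assms(2)[OF f] by (auto simp: constant_on_def)
    then show ?thesis by simp
  next
    case False
    then show ?thesis
      using holomorphic_countable_zeros[of f UNIV] assms(2)[OF f] by (simp add: connected_UNIV)
  qed
  then have "countable (\<Union>f\<in>A. {z. f z = 0})" using assms(1) countable_finite by blast
  then have "(\<Union>f\<in>A. {z. f z = 0}) \<noteq> UNIV" using uncountable_UNIV_complex by metis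
  then show ?thesis using that by blast
qed

lemma vanishes_if_small_on_circles:
  fixes E :: "complex \<Rightarrow> complex"
  assumes E: "E holomorphic_on UNIV"
    and small: "\<And>\<epsilon> R. 0 < \<epsilon> \<Longrightarrow> \<epsilon> \<le> 1 / 8 \<Longrightarrow> \<exists>r>R. \<forall>z. norm (z - w) = r \<longrightarrow> norm (E z) \<le> C * \<epsilon>"
  shows "E z = 0"
proof (rule ccontr)
  assume nz: "E z \<noteq> 0"
  \<comment> \<open>Chosen so that \<open>C * \<epsilon>\<close> is at most half of
    \<open>norm (E z)\<close>, within the range allowed by \<open>small\<close>.\<close>
  define \<epsilon> where "\<epsilon> = min (1 / 8) (norm (E z) / (2 * (1 + \<bar>C\<bar>)))"
  have \<epsilon>: "0 < \<epsilon>" "\<epsilon> \<le> 1 / 8" using nz unfolding \<epsilon>_def by (simp_all only: min.cobounded1) auto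
  obtain r where r: "r > norm (z - w)" "\<And>y. norm (y - w) = r \<Longrightarrow> norm (E y) \<le> C * \<epsilon>"
    using small[OF \<epsilon>] by blast
  have r0: "r > 0" using r(1) norm_ge_zero[of "z - w"] by linarith
  have "norm (E z) \<le> C * \<epsilon>"
  proof (rule maximum_modulus_frontier[where f = E and S = "cball w r" and \<xi> = z])
    show "E holomorphic_on interior (cball w r)" using E holomorphic_on_subset by blast
    show "continuous_on (closure (cball w r)) E"
      using E holomorphic_on_imp_continuous_on holomorphic_on_subset by blast
    show "z \<in> cball w r" using r(1) by (simp add: dist_norm norm_minus_commute)
    show "norm (E y) \<le> C * \<epsilon>" if "y \<in> frontier (cball w r)" for y
      using that r0 by (intro r(2)) (simp add: dist_norm norm_minus_commute)
  qed simp
  also have "\<dots> \<le> (1 + \<bar>C\<bar>) * \<epsilon>" using \<epsilon> by (intro mult_right_mono) auto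
  also have "\<dots> \<le> (1 + \<bar>C\<bar>) * (norm (E z) / (2 * (1 + \<bar>C\<bar>)))"
    by (intro mult_left_mono) (auto simp: \<epsilon>_def)
  also have "\<dots> = norm (E z) / 2" by (simp add: divide_simps)
  finally show False using nz by simp
qed

text \<open>Euclid's lemma without multiplicities: \<open>X / B\<close> and \<open>Y / A\<close>
  agree where both are defined, and their domains cover the plane because \<open>A\<close> and
  \<open>B\<close> have no common zero.\<close>

lemma coprime_divisor_cofactor:
  fixes A B X Y :: "complex \<Rightarrow> complex"
  assumes hol: "A holomorphic_on UNIV" "B holomorphic_on UNIV" "X holomorphic_on UNIV" "Y holomorphic_on UNIV"
    and eq: "\<And>z. A z * X z = B z * Y z" and cop: "\<And>z. A z = 0 \<Longrightarrow> B z \<noteq> 0"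
  obtains H where "H holomorphic_on UNIV" "\<And>z. X z = B z * H z"
proof -
  define H where "H z = (if B z \<noteq> 0 then X z / B z else Y z / A z)" for z
  have HA: "H z = Y z / A z" if "A z \<noteq> 0" for z
    using that eq[of z] by (auto simp: H_def field_simps)
  have op: "open {z. A z \<noteq> 0}" "open {z. B z \<noteq> 0}"
    using hol(1,2) by (auto intro!: open_Collect_neq holomorphic_on_imp_continuous_on continuous_intros)
  have "(\<lambda>z. Y z / A z) holomorphic_on {z. A z \<noteq> 0}" "(\<lambda>z. X z / B z) holomorphic_on {z. B z \<noteq> 0}"
    using hol holomorphic_on_subset by (blast intro: holomorphic_on_divide)+
  then have "H holomorphic_on {z. A z \<noteq> 0}" "H holomorphic_on {z. B z \<noteq> 0}"
    using HA by (auto simp: H_def elim!: holomorphic_transform)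
  then have "H holomorphic_on {z. A z \<noteq> 0} \<union> {z. B z \<noteq> 0}"
    using op by (simp add: holomorphic_on_Un)
  moreover have "{z. A z \<noteq> 0} \<union> {z. B z \<noteq> 0} = UNIV" using cop by blast
  moreover have "X z = B z * H z" for z
    using eq[of z] cop[of z] by (cases "B z = 0") (auto simp: H_def)
  ultimately show ?thesis by (metis that)
qed

text \<open>If all differences vanished at \<open>z\<close>, they would vanish at every
  \<open>z + of_nat j\<close>, and so would \<open>f\<close>. One nonzero value to the right thus
  makes the length finite.\<close>

lemma zero_imp_zero_of_length:
  assumes "f z = 0" "f (z + of_nat k) \<noteq> 0"
  obtains m where "zero_of_length f z m"
proof -
  have "\<exists>m. (fdiff ^^ m) f z \<noteq> 0"
  proof (rule ccontr)
    assume no: "\<not> ?thesis"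
    have "\<forall>i. (fdiff ^^ i) f (z + of_nat j) = 0" for j
    proof (induction j)
      case (Suc j)
      show ?case
      proof
        fix i
        have "(fdiff ^^ Suc i) f (z + of_nat j) = (fdiff ^^ i) f (z + of_nat j + 1) - (fdiff ^^ i) f (z + of_nat j)"
          by (simp add: fdiff_def)
        then show "(fdiff ^^ i) f (z + of_nat (Suc j)) = 0"
          using Suc[rule_format, of "Suc i"] Suc[rule_format, of i] by (simp add: add_ac)
      qed
    qed (use no in auto)
    from this[of k, rule_format, of 0] assms(2) show False by simp
  qed
  then obtain m where m: "(fdiff ^^ m) f z \<noteq> 0" "\<And>i. i < m \<Longrightarrow> (fdiff ^^ i) f z = 0"
    using exists_least_iff[of "\<lambda>m. (fdiff ^^ m) f z \<noteq> 0"] by auto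
  then have "m \<noteq> 0" using assms(1) by (cases m) auto
  then show ?thesis using m by (intro that[of m]) (auto simp: zero_of_length_def)
qed

text \<open>With \<open>m1 = n1 = 1\<close>, the product of \<open>z - x\<close> and
  \<open>z - y\<close> is the falling square based at the left one of the two adjacent
  zeros.\<close>

lemma adjacent_zeros_common_shifting_divisor:
  assumes f: "f holomorphic_on UNIV" and g: "g holomorphic_on UNIV"
    and len: "zero_of_length f x m'" "zero_of_length g y n'"
    and adj: "y = x + 1 \<or> x = y + 1"
  shows "\<exists>z0. common_shifting_divisor f g z0"
proof -
  have z: "f x = 0" "g y = 0" and mn: "1 \<le> m'" "1 \<le> n'"
    using len unfolding zero_of_length_def by (auto dest!: spec[of _ 0])
  obtain F where F: "F holomorphic_on UNIV" "\<And>z. f z = (z - x) * F z" using extract_zero[OF f z(1)] by blast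
  obtain G where G: "G holomorphic_on UNIV" "\<And>z. g z = (z - y) * G z" using extract_zero[OF g z(2)] by blast
  have one: "falling_power (\<lambda>w. w - u) 1 z = z - u" for u z by (simp add: falling_power_def)
  have two: "falling_power (\<lambda>w. w - u) (1 + 1) z = (z - u) * (z - 1 - u)" for u z
    by (simp add: falling_power_def numeral_2_eq_2)
  define z0 where "z0 = (if y = x + 1 then x else y)"
  have "common_shifting_divisor f g z0"
    unfolding common_shifting_divisor_def
  proof (rule exI[of _ x], rule exI[of _ y], rule exI[of _ m'], rule exI[of _ n'], rule exI[of _ 1],
      rule exI[of _ 1], rule exI[of _ F], rule exI[of _ G], intro conjI)
    show "\<forall>z. f z * g z = falling_power (\<lambda>w. w - z0) (1 + 1) z * F z * G z"
      unfolding two F(2) G(2) using adj by (auto simp: z0_def algebra_simps)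
  qed (use len mn F G adj in \<open>auto simp: one[unfolded One_nat_def] z0_def\<close>)
  then show ?thesis by blast
qed

section \<open>Falling powers on large circles\<close>

lemma quotient_near_one:
  fixes u v :: complex
  assumes u: "norm (u - 1) \<le> \<epsilon>" and v: "norm (v - 1) \<le> \<epsilon>" and \<epsilon>: "\<epsilon> \<le> 1 / 2"
  shows "norm (u - v) \<le> 4 * \<epsilon> * norm v" "1 / 2 \<le> norm v" "norm v \<le> 2"
proof -
  show v2: "1 / 2 \<le> norm v" "norm v \<le> 2"
    using norm_triangle_ineq3[of v 1] v \<epsilon> by auto
  have "\<epsilon> \<ge> 0" using u norm_ge_zero order_trans by blast
  have "norm (u - v) = norm ((u - 1) - (v - 1))" by simp
  also have "\<dots> \<le> 2 * \<epsilon>" using norm_triangle_ineq4[of "u - 1" "v - 1"] u v by linarith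
  also have "\<dots> = 4 * \<epsilon> * (1 / 2)" by simp
  also have "\<dots> \<le> 4 * \<epsilon> * norm v" using v2 \<open>\<epsilon> \<ge> 0\<close> by (intro mult_left_mono) auto
  finally show "norm (u - v) \<le> 4 * \<epsilon> * norm v" .
qed

text \<open>A unit shift of the falling power replaces only the factor
  \<open>f (z - of_nat m)\<close> by \<open>f (z + 1)\<close>, and both are close to
  \<open>f z\<close> on a good circle. Shifts up to \<open>m + 1\<close> suffice.\<close>

lemma circle_estimates:
  fixes A :: "(complex \<Rightarrow> complex) set"
  assumes fin: "finite A" and \<epsilon>: "0 < \<epsilon>" "\<epsilon> \<le> 1 / 2"
    and A: "\<And>f. f \<in> A \<Longrightarrow> f holomorphic_on UNIV \<and> growth_order f < 1 \<and> f w \<noteq> 0"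
  obtains r where "r > R0"
    "\<And>f z k. f \<in> A \<Longrightarrow> norm (z - w) = r \<Longrightarrow> k \<le> m \<Longrightarrow>
      norm (f (z - of_nat k)) \<le> 2 * norm (f z) \<and> norm (f z) \<le> 2 * norm (f (z - of_nat k)) \<and> f (z - of_nat k) \<noteq> 0"
    "\<And>f z. f \<in> A \<Longrightarrow> norm (z - w) = r \<Longrightarrow>
      norm (falling_power f (Suc m) (z + 1) - falling_power f (Suc m) z) \<le> 4 * \<epsilon> * norm (falling_power f (Suc m) z)"
proof -
  obtain r where r: "r > R0" "\<And>f z. f \<in> A \<Longrightarrow> norm (z - w) = r \<Longrightarrow> f z \<noteq> 0"
    and near: "\<And>f z s. f \<in> A \<Longrightarrow> norm (z - w) = r \<Longrightarrow> norm s \<le> real m + 1 \<Longrightarrow> norm (f (z + s) / f z - 1) \<le> \<epsilon>"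
    by (rule shift_ratio_near_one[of A \<epsilon> w R0 "real m + 1", OF fin \<epsilon>(1) A]) auto
  have down: "norm (f (z - of_nat k) / f z - 1) \<le> \<epsilon>"
    if "f \<in> A" "norm (z - w) = r" "k \<le> m" for f z k
    using near[OF that(1,2), of "- of_nat k"] that(3) by simp
  have up: "norm (f (z + 1) / f z - 1) \<le> \<epsilon>" if "f \<in> A" "norm (z - w) = r" for f z
    using near[OF that, of 1] by simp
  show ?thesis
  proof (rule that[OF r(1)])
    fix f z k assume f: "f \<in> A" and z: "norm (z - w) = r" and k: "k \<le> m"
    have nz: "f z \<noteq> 0" by (rule r(2)[OF f z])
    from quotient_near_one(2,3)[OF down[OF f z k] down[OF f z k] \<epsilon>(2)] nz
    show "norm (f (z - of_nat k)) \<le> 2 * norm (f z) \<and> norm (f z) \<le> 2 * norm (f (z - of_nat k)) \<and> f (z - of_nat k) \<noteq> 0"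
      by (auto simp: norm_divide field_simps)
  next
    fix f z assume f: "f \<in> A" and z: "norm (z - w) = r"
    have nz: "f z \<noteq> 0" by (rule r(2)[OF f z])
    have "norm (f (z + 1) / f z - f (z - of_nat m) / f z) \<le> 4 * \<epsilon> * norm (f (z - of_nat m) / f z)"
      by (rule quotient_near_one(1)[OF up[OF f z] down[OF f z order_refl] \<epsilon>(2)])
    then have "norm (f (z + 1) - f (z - of_nat m)) \<le> 4 * \<epsilon> * norm (f (z - of_nat m))"
      using nz by (simp add: norm_divide divide_simps flip: diff_divide_distrib)
    then have "norm (falling_power f m z) * norm (f (z + 1) - f (z - of_nat m))
        \<le> norm (falling_power f m z) * (4 * \<epsilon> * norm (f (z - of_nat m)))"
      by (intro mult_left_mono) auto
    moreover have "falling_power f (Suc m) (z + 1) - falling_power f (Suc m) z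
        = falling_power f m z * (f (z + 1) - f (z - of_nat m))"
      unfolding falling_power_Suc_shift unfolding falling_power_Suc by (simp add: algebra_simps)
    ultimately show "norm (falling_power f (Suc m) (z + 1) - falling_power f (Suc m) z)
        \<le> 4 * \<epsilon> * norm (falling_power f (Suc m) z)"
      by (simp add: norm_mult falling_power_Suc mult_ac)
  qed
qed

text \<open>For each fixed \<open>s\<close> the ratio \<open>f (z + s) / f z\<close> is entire in
  \<open>z\<close>, so its deviation from 1 vanishes by smallness on circles.\<close>

lemma zero_free_constant:
  fixes f :: "complex \<Rightarrow> complex"
  assumes f: "f holomorphic_on UNIV" "growth_order f < 1" and nz: "\<And>z. f z \<noteq> 0"
  shows "f constant_on UNIV"
proof -
  have "f (0 + s) / f 0 - 1 = 0" for s
  proof (rule vanishes_if_small_on_circles[where w = 0 and C = 1 and E = "\<lambda>z. f (z + s) / f z - 1"])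
    show "(\<lambda>z. f (z + s) / f z - 1) holomorphic_on UNIV"
      by (intro holomorphic_intros holomorphic_shift f nz)
    fix \<epsilon> R :: real assume \<epsilon>: "0 < \<epsilon>"
    show "\<exists>r>R. \<forall>z. norm (z - 0) = r \<longrightarrow> norm (f (z + s) / f z - 1) \<le> 1 * \<epsilon>"
      by (rule shift_ratio_near_one[of "{f}" \<epsilon> 0 R "norm s"]) (use f nz \<epsilon> in auto)
  qed
  then have "f s = f 0" for s using nz[of 0] by simp
  then show ?thesis by (metis constant_on_def)
qed

text \<open>The half-line from \<open>x\<close> to the right crosses a good circle. Zeros at all
  \<open>x + of_nat k\<close> would put a zero of \<open>f\<close> within distance
  \<open>n + 1\<close> of the crossing point, where the shift ratio would be 0 instead of near
  1.\<close>

lemma falling_power_zeros_not_propagating: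
  fixes f :: "complex \<Rightarrow> complex"
  assumes f: "f holomorphic_on UNIV" "growth_order f < 1" "f w \<noteq> 0"
  obtains k where "falling_power f n (x + of_nat k) \<noteq> 0"
proof (rule ccontr)
  assume "\<not> thesis"
  then have all: "falling_power f n (x + of_nat k) = 0" for k using that by blast
  obtain r where r: "r > norm (x - w)" "\<And>z. norm (z - w) = r \<Longrightarrow> f z \<noteq> 0"
    and near: "\<And>z s. norm (z - w) = r \<Longrightarrow> norm s \<le> real n + 1 \<Longrightarrow> norm (f (z + s) / f z - 1) \<le> 1 / 2"
    by (rule shift_ratio_near_one[of "{f}" "1/2" w "norm (x - w)" "real n + 1"]) (use f in auto)
  define h where "h t = norm (x + of_real t - w)" for t :: real
  \<comment> \<open>By the triangle inequality \<open>h T \<ge> T - norm (x - w) = r\<close>, so the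
    circle is reached by time \<open>T\<close>.\<close>
  define T where "T = norm (x - w) + r"
  have T0: "0 \<le> T" using r(1) norm_ge_zero[of "x - w"] unfolding T_def by linarith
  have "h 0 \<le> r" using r(1) by (simp add: h_def)
  moreover have "T \<le> h T + norm (x - w)"
    using norm_triangle_ineq4[of "x + of_real T - w" "x - w"] T0 by (simp add: h_def)
  then have "r \<le> h T" by (simp add: T_def)
  moreover have "continuous_on {0..T} h" unfolding h_def by (intro continuous_intros)
  ultimately obtain t where t: "0 \<le> t" "t \<le> T" "h t = r" using IVT'[of h 0 r T] T0 by auto
  define k where "k = nat \<lceil>t\<rceil>"
  have k: "0 \<le> real k - t" "real k - t \<le> 1" using t unfolding k_def by linarith+
  obtain j where j: "j < n" "f (x + of_nat k - of_nat j) = 0"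
    using all[of k] by (auto simp: falling_power_def)
  have "norm (of_real (real k - t - real j) :: complex) \<le> real n + 1"
    unfolding norm_of_real using k j by linarith
  from near[OF _ this, of "x + of_real t"] j(2) t(3) show False
    by (simp add: h_def algebra_simps)
qed

section \<open>Casoratians of falling powers\<close>

text \<open>The difference analogue of the Wronskian, equal to
  \<open>f z * fdiff g z - fdiff f z * g z\<close>.\<close>

definition casoratian :: "(complex \<Rightarrow> complex) \<Rightarrow> (complex \<Rightarrow> complex) \<Rightarrow> complex \<Rightarrow> complex" where
  "casoratian f g z = f z * g (z + 1) - f (z + 1) * g z"

lemma casoratian_falling_power:
  "casoratian (falling_power a (Suc m)) g z = falling_power a m z * (a (z - of_nat m) * g (z + 1) - a (z + 1) * g z)"
  unfolding casoratian_def falling_power_Suc_shift unfolding falling_power_Suc by (simp add: algebra_simps)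

lemma casoratian_bound:
  assumes "norm (f (z + 1) - f z) \<le> \<eta> * norm (f z)" "norm (g (z + 1) - g z) \<le> \<eta> * norm (g z)"
  shows "norm (casoratian f g z) \<le> 2 * \<eta> * (norm (f z) * norm (g z))"
proof -
  have "casoratian f g z = f z * (g (z + 1) - g z) - (f (z + 1) - f z) * g z"
    by (simp add: casoratian_def algebra_simps)
  then have "norm (casoratian f g z) \<le> norm (f z) * norm (g (z + 1) - g z) + norm (f (z + 1) - f z) * norm (g z)"
    by (metis norm_mult norm_triangle_ineq4)
  also have "\<dots> \<le> norm (f z) * (\<eta> * norm (g z)) + (\<eta> * norm (f z)) * norm (g z)"
    using assms by (intro add_mono mult_left_mono mult_right_mono) auto
  finally show ?thesis by (simp add: algebra_simps)
qed

lemma casoratian_zero_imp_constant: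
  fixes a :: "complex \<Rightarrow> complex"
  assumes a: "a holomorphic_on UNIV" "growth_order a < 1" "a w \<noteq> 0"
    and cas: "\<And>z. casoratian (falling_power a (Suc m)) g z = 0"
    and cop: "\<And>z. falling_power a (Suc m) z = 0 \<Longrightarrow> g z \<noteq> 0"
  shows "a constant_on UNIV"
proof (rule zero_free_constant[OF a(1,2)])
  fix x
  \<comment> \<open>At a zero of the falling power the casoratian reduces to
    \<open>- falling_power a (Suc m) (z + 1) * g z\<close>.\<close>
  have step: "falling_power a (Suc m) (z + 1) = 0" if "falling_power a (Suc m) z = 0" for z
    using cas[of z] cop[OF that] that by (simp add: casoratian_def)
  show "a x \<noteq> 0"
  proof
    assume "a x = 0"
    have "falling_power a (Suc m) (x + of_nat k) = 0" for k
    proof (induction k)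
      case 0
      show ?case using \<open>a x = 0\<close>
        by (simp add: falling_power_def prod.lessThan_Suc_shift del: prod.lessThan_Suc)
    next
      case (Suc k)
      from step[OF this] show ?case by (simp add: add_ac)
    qed
    then show False by - (rule falling_power_zeros_not_propagating[OF a], auto)
  qed
qed

text \<open>Written with different pairs, the same casoratian up to nonzero constants shows the
  factors \<open>A\<close>, \<open>B\<close> and \<open>C\<close> in turn. They have no common zeros
  pairwise, since they divide \<open>f\<close>, \<open>g\<close> and \<open>h\<close>, so they can
  be split off one after another.\<close>

lemma casoratian_divisible:
  fixes a b c :: "complex \<Rightarrow> complex" and m :: nat
  defines "f \<equiv> falling_power a (Suc m)" and "g \<equiv> falling_power b (Suc m)" and "h \<equiv> falling_power c (Suc m)"
  assumes hol: "a holomorphic_on UNIV" "b holomorphic_on UNIV" "c holomorphic_on UNIV"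
    and cop: "\<And>z. f z = 0 \<Longrightarrow> g z \<noteq> 0" "\<And>z. f z = 0 \<Longrightarrow> h z \<noteq> 0" "\<And>z. g z = 0 \<Longrightarrow> h z \<noteq> 0"
    and \<mu>: "\<mu> \<noteq> 0" "\<And>z. casoratian f h z = \<mu> * casoratian f g z"
  obtains H where "H holomorphic_on UNIV"
    "\<And>z. casoratian f g z = falling_power (\<lambda>z. a z * b z * c z) m z * H z"
proof -
  define A B C where ABC: "A = falling_power a m" "B = falling_power b m" "C = falling_power c m"
  have holABC: "A holomorphic_on UNIV" "B holomorphic_on UNIV" "C holomorphic_on UNIV"
    unfolding ABC by (intro holomorphic_falling_power hol)+
  have holfg: "f holomorphic_on UNIV" "g holomorphic_on UNIV"
    unfolding f_def g_def by (intro holomorphic_falling_power hol)+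
  have zero: "A z = 0 \<Longrightarrow> f z = 0" "B z = 0 \<Longrightarrow> g z = 0" "C z = 0 \<Longrightarrow> h z = 0" for z
    by (simp_all add: ABC f_def g_def h_def falling_power_Suc)
  define X where "X z = a (z - of_nat m) * g (z + 1) - a (z + 1) * g z" for z
  define Y where "Y z = b (z + 1) * f z - b (z - of_nat m) * f (z + 1)" for z
  define Z where "Z z = (c (z + 1) * f z - c (z - of_nat m) * f (z + 1)) / \<mu>" for z
  have holXYZ: "X holomorphic_on UNIV" "Y holomorphic_on UNIV" "Z holomorphic_on UNIV"
    unfolding X_def[abs_def] Y_def[abs_def] Z_def[abs_def]
    by (intro holomorphic_intros holomorphic_shift hol holfg \<mu>(1))+
  have swap: "casoratian u v z = - casoratian v u z" for u v z
    by (simp add: casoratian_def)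
  have WX: "casoratian f g z = A z * X z" for z
    unfolding f_def ABC X_def casoratian_falling_power by simp
  have WY: "casoratian f g z = B z * Y z" for z
    unfolding swap[of f g] unfolding g_def casoratian_falling_power ABC Y_def by (simp add: algebra_simps)
  have "\<mu> * casoratian f g z = C z * (\<mu> * Z z)" for z
    unfolding \<mu>(2)[symmetric] swap[of f h] unfolding h_def casoratian_falling_power ABC Z_def
    using \<mu>(1) by (simp add: field_simps)
  then have WZ: "casoratian f g z = C z * Z z" for z
    using \<mu>(1) by (metis mult.left_commute mult_left_cancel)
  obtain H1 where H1: "H1 holomorphic_on UNIV" "\<And>z. X z = B z * H1 z"
    by (rule coprime_divisor_cofactor[OF holABC(1,2) holXYZ(1,2)])
      (use WX WY zero cop in \<open>metis\<close>)+
  have "(\<lambda>z. A z * B z) holomorphic_on UNIV" by (intro holomorphic_intros holABC)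
  then obtain H where H: "H holomorphic_on UNIV" "\<And>z. H1 z = C z * H z"
  proof (rule coprime_divisor_cofactor[OF _ holABC(3) H1(1) holXYZ(3)])
    show "A z * B z * H1 z = C z * Z z" for z
      using WX[of z] WZ[of z] H1(2)[of z] by simp
    show "C z \<noteq> 0" if "A z * B z = 0" for z
      using that zero[of z] cop[of z] by auto
  qed auto
  show ?thesis
  proof (rule that[OF H(1)])
    fix z
    have "falling_power (\<lambda>z. a z * b z * c z) m z = A z * B z * C z"
      by (simp add: ABC falling_power_def prod.distrib)
    then show "casoratian f g z = falling_power (\<lambda>z. a z * b z * c z) m z * H z"
      using WX[of z] H1(2)[of z] H(2)[of z] by simp
  qed
qed

text \<open>Writing \<open>W = D * H\<close>, products of the estimates for \<open>W\<close> carry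
  powers of \<open>D\<close> on both sides. After cancellation an entire expression in
  \<open>H\<close> is small on the circles. The two cases differ in how many estimates are
  multiplied.\<close>

lemma falling_casoratian_vanishes:
  fixes a b c :: "complex \<Rightarrow> complex" and m :: nat
  defines "f \<equiv> falling_power a (Suc m)" and "g \<equiv> falling_power b (Suc m)" and "h \<equiv> falling_power c (Suc m)"
  assumes a: "a holomorphic_on UNIV" "growth_order a < 1" "a w \<noteq> 0"
    and b: "b holomorphic_on UNIV" "growth_order b < 1" "b w \<noteq> 0"
    and c: "c holomorphic_on UNIV" "growth_order c < 1" "c w \<noteq> 0"
    and cop: "\<And>z. f z = 0 \<Longrightarrow> g z \<noteq> 0" "\<And>z. f z = 0 \<Longrightarrow> h z \<noteq> 0" "\<And>z. g z = 0 \<Longrightarrow> h z \<noteq> 0"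
    and nz: "\<mu> \<noteq> 0" "\<nu> \<noteq> 0"
    and rel: "\<And>z. casoratian f h z = \<mu> * casoratian f g z" "\<And>z. casoratian g h z = \<nu> * casoratian f g z"
    and m: "m \<ge> 1" "m \<ge> 2 \<or> a constant_on UNIV"
  shows "casoratian f g z = 0"
proof -
  define P where "P z = a z * b z * c z" for z
  define D where "D = falling_power P m"
  define W where "W = casoratian f g"
  obtain H where H: "H holomorphic_on UNIV" "\<And>z. W z = D z * H z"
    unfolding W_def D_def P_def
    by (rule casoratian_divisible[OF a(1) b(1) c(1) cop[unfolded f_def g_def h_def] nz(1)
          rel(1)[unfolded f_def g_def h_def], folded f_def g_def]) auto
  have holP: "P holomorphic_on UNIV" unfolding P_def[abs_def] by (intro holomorphic_intros a b c)
  \<comment> \<open>Each of \<open>f\<close>, \<open>g\<close>, \<open>h\<close> has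
    \<open>m + 1\<close> factors but \<open>D\<close> only \<open>m\<close> values of
    \<open>P\<close>, so the last value of \<open>P\<close> is left over.\<close>
  have fgh: "f z * g z * h z = D z * P (z - of_nat m)" for z
    by (simp add: f_def g_def h_def D_def falling_power_def P_def prod.distrib)
  have circ: "\<exists>r>R. \<forall>z. norm (z - w) = r \<longrightarrow> norm (W z) \<le> 8 * \<epsilon> * (norm (f z) * norm (g z)) \<and>
      norm \<mu> * norm (W z) \<le> 8 * \<epsilon> * (norm (f z) * norm (h z)) \<and>
      norm \<nu> * norm (W z) \<le> 8 * \<epsilon> * (norm (g z) * norm (h z)) \<and>
      (\<forall>k\<le>m. P (z - of_nat k) \<noteq> 0 \<and> norm (P (z - of_nat m)) \<le> 64 * norm (P (z - of_nat k)))"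
    if \<epsilon>: "0 < \<epsilon>" "\<epsilon> \<le> 1 / 8" for \<epsilon> R :: real
  proof -
    have \<epsilon>2: "\<epsilon> \<le> 1 / 2" using \<epsilon> by simp
    have hyp: "u \<in> {a, b, c} \<Longrightarrow> u holomorphic_on UNIV \<and> growth_order u < 1 \<and> u w \<noteq> 0" for u
      using a b c by auto
    obtain r where r: "r > R" and e1: "\<And>u z k. u \<in> {a, b, c} \<Longrightarrow> norm (z - w) = r \<Longrightarrow> k \<le> m \<Longrightarrow>
        norm (u (z - of_nat k)) \<le> 2 * norm (u z) \<and> norm (u z) \<le> 2 * norm (u (z - of_nat k)) \<and> u (z - of_nat k) \<noteq> 0"
      and e2: "\<And>u z. u \<in> {a, b, c} \<Longrightarrow> norm (z - w) = r \<Longrightarrow>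
        norm (falling_power u (Suc m) (z + 1) - falling_power u (Suc m) z) \<le> 4 * \<epsilon> * norm (falling_power u (Suc m) z)"
      by (rule circle_estimates[of "{a, b, c}" \<epsilon> w R m, OF _ \<epsilon>(1) \<epsilon>2 hyp]) auto
    have abc: "a \<in> {a, b, c}" "b \<in> {a, b, c}" "c \<in> {a, b, c}" by auto
    show ?thesis
    proof (intro exI[of _ r] conjI allI impI r)
      fix z assume z: "norm (z - w) = r"
      note d = e2[OF abc(1) z, folded f_def] e2[OF abc(2) z, folded g_def] e2[OF abc(3) z, folded h_def]
      show "norm (W z) \<le> 8 * \<epsilon> * (norm (f z) * norm (g z))"
        using casoratian_bound[OF d(1) d(2)] by (simp add: W_def)
      show "norm \<mu> * norm (W z) \<le> 8 * \<epsilon> * (norm (f z) * norm (h z))"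
        using casoratian_bound[OF d(1) d(3)] by (simp add: W_def rel norm_mult)
      show "norm \<nu> * norm (W z) \<le> 8 * \<epsilon> * (norm (g z) * norm (h z))"
        using casoratian_bound[OF d(2) d(3)] by (simp add: W_def rel norm_mult)
      fix k assume k: "k \<le> m"
      show "P (z - of_nat k) \<noteq> 0"
        using e1[OF abc(1) z k] e1[OF abc(2) z k] e1[OF abc(3) z k] by (simp add: P_def)
      \<comment> \<open>Comparison through \<open>u z\<close> costs \<open>2 * 2\<close>; over the
        three functions this gives the constant 64.\<close>
      have 4: "norm (u (z - of_nat m)) \<le> 4 * norm (u (z - of_nat k))" if "u \<in> {a, b, c}" for u
        using e1[OF that z k] e1[OF that z order_refl] by linarith
      have "norm (P (z - of_nat m)) \<le> (4 * norm (a (z - of_nat k))) * (4 * norm (b (z - of_nat k))) * (4 * norm (c (z - of_nat k)))"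
        unfolding P_def norm_mult by (intro mult_mono 4 abc) auto
      then show "norm (P (z - of_nat m)) \<le> 64 * norm (P (z - of_nat k))"
        by (simp add: P_def norm_mult)
    qed
  qed
  show ?thesis
  proof (cases "m \<ge> 2")
    case True
    define Q where "Q z = (\<Prod>k\<in>{2..<m}. P (z - of_nat k))" for z
    have DQ: "D z = P z * P (z - 1) * Q z" for z
    proof -
      have "{..<m} = insert 0 (insert 1 {2..<m})" using True by auto
      then show ?thesis by (simp add: D_def falling_power_def Q_def)
    qed
    have "H z ^ 3 * Q z = 0" for z
    \<comment> \<open>The constant is \<open>8 * 64 * 64\<close>: one factor 8 from the casoratian
      bounds, and 64 for each of the two values of \<open>P\<close> being compared.\<close>
    proof (rule vanishes_if_small_on_circles[where w = w and C = "32768 / (norm \<mu> * norm \<nu>)" and E = "\<lambda>z. H z ^ 3 * Q z"])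
      show "(\<lambda>z. H z ^ 3 * Q z) holomorphic_on UNIV"
        unfolding Q_def by (intro holomorphic_intros H holomorphic_shift holP)
      fix \<epsilon> R :: real assume \<epsilon>: "0 < \<epsilon>" "\<epsilon> \<le> 1 / 8"
      have est: "norm (H z ^ 3 * Q z) \<le> 32768 / (norm \<mu> * norm \<nu>) * \<epsilon>"
        if W: "norm (W z) \<le> 8 * \<epsilon> * (norm (f z) * norm (g z))"
           "norm \<mu> * norm (W z) \<le> 8 * \<epsilon> * (norm (f z) * norm (h z))"
           "norm \<nu> * norm (W z) \<le> 8 * \<epsilon> * (norm (g z) * norm (h z))"
          and Pk: "\<forall>k\<le>m. P (z - of_nat k) \<noteq> 0 \<and> norm (P (z - of_nat m)) \<le> 64 * norm (P (z - of_nat k))" for z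
      proof -
        define p where "p = norm (P (z - of_nat m))"
        have p0: "p \<le> 64 * norm (P z)" "p \<le> 64 * norm (P (z - 1))"
          using Pk True unfolding p_def by (auto dest: spec[of _ 0] spec[of _ 1])
        have Dz: "D z \<noteq> 0" unfolding D_def falling_power_def using Pk by auto
        then have PP: "0 < norm (P z * P (z - 1))" by (auto simp: DQ)
        have "(norm (W z) * (norm \<mu> * norm (W z))) * (norm \<nu> * norm (W z))
          \<le> (8 * \<epsilon> * (norm (f z) * norm (g z)) * (8 * \<epsilon> * (norm (f z) * norm (h z)))) * (8 * \<epsilon> * (norm (g z) * norm (h z)))"
          using \<epsilon> by (intro mult_mono W) auto
        also have "\<dots> = (8 * \<epsilon>) ^ 3 * (norm (f z * g z * h z))\<^sup>2"
          by (simp add: norm_mult power2_eq_square power3_eq_cube mult_ac)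
        also have "\<dots> = norm (D z) ^ 2 * ((8 * \<epsilon>) ^ 3 * p\<^sup>2)"
          unfolding fgh by (simp add: norm_mult p_def power_mult_distrib mult_ac)
        finally have "norm (D z) ^ 2 * (norm \<mu> * norm \<nu> * (norm (D z) * norm (H z) ^ 3)) \<le> norm (D z) ^ 2 * ((8 * \<epsilon>) ^ 3 * p\<^sup>2)"
          by (simp add: H(2) norm_mult power2_eq_square power3_eq_cube mult_ac)
        then have "norm \<mu> * norm \<nu> * (norm (D z) * norm (H z) ^ 3) \<le> (8 * \<epsilon>) ^ 3 * p\<^sup>2"
          using Dz by (simp add: mult_le_cancel_left)
        \<comment> \<open>The two left-over values of \<open>P\<close> are traded for
          \<open>P z\<close> and \<open>P (z - 1)\<close>, distinct factors of \<open>D\<close>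
          because \<open>m \<ge> 2\<close>; what remains of \<open>D\<close> is
          \<open>Q\<close>.\<close>
        also have "\<dots> \<le> (8 * \<epsilon>) * (64 * norm (P z) * (64 * norm (P (z - 1))))"
        proof (intro mult_mono)
          show "(8 * \<epsilon>) ^ 3 \<le> 8 * \<epsilon>" using power_decreasing[of 1 3 "8 * \<epsilon>"] \<epsilon> by simp
          show "p\<^sup>2 \<le> 64 * norm (P z) * (64 * norm (P (z - 1)))"
            unfolding power2_eq_square using p0 by (intro mult_mono) (auto simp: p_def)
        qed (use \<epsilon> in auto)
        also have "\<dots> = norm (P z * P (z - 1)) * (32768 * \<epsilon>)" by (simp add: norm_mult)
        finally have "norm (P z * P (z - 1)) * (norm \<mu> * norm \<nu> * norm (H z ^ 3 * Q z)) \<le> norm (P z * P (z - 1)) * (32768 * \<epsilon>)"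
          by (simp add: DQ norm_mult norm_power mult_ac)
        then have "norm \<mu> * norm \<nu> * norm (H z ^ 3 * Q z) \<le> 32768 * \<epsilon>"
          by (rule mult_left_le_imp_le) (rule PP)
        then show ?thesis using nz by (simp add: field_simps)
      qed
      show "\<exists>r>R. \<forall>z. norm (z - w) = r \<longrightarrow> norm (H z ^ 3 * Q z) \<le> 32768 / (norm \<mu> * norm \<nu>) * \<epsilon>"
        using circ[OF \<epsilon>, of R] est by meson
    qed
    \<comment> \<open>Either \<open>H z = 0\<close> or \<open>Q z = 0\<close>, and both are factors
      of \<open>W z\<close>.\<close>
    from this[of z] show ?thesis unfolding W_def[symmetric] H(2) DQ by auto
  next
    case False
    then have m1: "m = 1" and con: "a constant_on UNIV" using m by auto
    obtain \<kappa> where \<kappa>: "\<And>z. a z = \<kappa>" using con by (auto simp: constant_on_def)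
    define K where "K = norm (\<kappa> ^ Suc m)"
    have fK: "norm (f z) = K" for z by (simp add: f_def falling_power_def \<kappa> K_def)
    have DP: "D z = P z" for z by (simp add: D_def falling_power_def m1)
    have "H z ^ 2 = 0" for z
    proof (rule vanishes_if_small_on_circles[where w = w and C = "512 * K / norm \<mu>" and E = "\<lambda>z. H z ^ 2"])
      show "(\<lambda>z. H z ^ 2) holomorphic_on UNIV" by (intro holomorphic_intros H)
      fix \<epsilon> R :: real assume \<epsilon>: "0 < \<epsilon>" "\<epsilon> \<le> 1 / 8"
      have est: "norm (H z ^ 2) \<le> 512 * K / norm \<mu> * \<epsilon>"
        if W: "norm (W z) \<le> 8 * \<epsilon> * (norm (f z) * norm (g z))"
           "norm \<mu> * norm (W z) \<le> 8 * \<epsilon> * (norm (f z) * norm (h z))"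
          and Pk: "\<forall>k\<le>m. P (z - of_nat k) \<noteq> 0 \<and> norm (P (z - of_nat m)) \<le> 64 * norm (P (z - of_nat k))" for z
      proof -
        have P0: "norm (P (z - of_nat m)) \<le> 64 * norm (P z)" "P z \<noteq> 0" using Pk by (auto dest: spec[of _ 0])
        have "norm (W z) * (norm \<mu> * norm (W z)) \<le> 8 * \<epsilon> * (norm (f z) * norm (g z)) * (8 * \<epsilon> * (norm (f z) * norm (h z)))"
          using \<epsilon> by (intro mult_mono W) auto
        \<comment> \<open>Since \<open>norm (f z)\<close> is the constant \<open>K\<close>, two
          estimates already produce the full product \<open>f z * g z * h z\<close>.\<close>
        also have "\<dots> = (8 * \<epsilon>)\<^sup>2 * K * norm (f z * g z * h z)"
          by (simp add: norm_mult power2_eq_square fK mult_ac)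
        also have "\<dots> \<le> (8 * \<epsilon>) * K * (norm (P z) * (64 * norm (P z)))"
        proof (intro mult_mono)
          show "(8 * \<epsilon>)\<^sup>2 \<le> 8 * \<epsilon>" using power_decreasing[of 1 2 "8 * \<epsilon>"] \<epsilon> by simp
          show "norm (f z * g z * h z) \<le> norm (P z) * (64 * norm (P z))"
            unfolding fgh DP norm_mult using P0 by (intro mult_left_mono) auto
        qed (use \<epsilon> in \<open>auto simp: K_def\<close>)
        finally have "(norm (P z))\<^sup>2 * (norm \<mu> * norm (H z ^ 2)) \<le> (norm (P z))\<^sup>2 * (512 * K * \<epsilon>)"
          by (simp add: H(2) DP norm_mult norm_power power2_eq_square mult_ac)
        then have "norm \<mu> * norm (H z ^ 2) \<le> 512 * K * \<epsilon>"
          by (rule mult_left_le_imp_le) (use P0 in simp)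
        then show ?thesis using nz by (simp add: field_simps)
      qed
      show "\<exists>r>R. \<forall>z. norm (z - w) = r \<longrightarrow> norm (H z ^ 2) \<le> 512 * K / norm \<mu> * \<epsilon>"
        using circ[OF \<epsilon>, of R] est by meson
    qed
    from this[of z] show ?thesis unfolding W_def[symmetric] H(2) by simp
  qed
qed

section \<open>From shifting primeness to the conclusion\<close>

text \<open>Zeros of \<open>f\<close> come in runs of \<open>m + 1\<close> consecutive points, at
  least two as \<open>m \<ge> 1\<close>. A common zero \<open>x\<close> therefore has a neighbouring
  zero of \<open>f\<close>, and this adjacent pair yields a common shifting divisor.\<close>

lemma shifting_prime_no_common_zero:
  fixes a b :: "complex \<Rightarrow> complex" and m :: nat
  defines "f \<equiv> falling_power a (Suc m)" and "g \<equiv> falling_power b (Suc m)"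
  assumes a: "a holomorphic_on UNIV" "growth_order a < 1" "a w \<noteq> 0"
    and b: "b holomorphic_on UNIV" "growth_order b < 1" "b w \<noteq> 0"
    and m: "m \<ge> 1" and prime: "rel_shifting_prime f g" and x: "f x = 0"
  shows "g x \<noteq> 0"
proof
  assume gx: "g x = 0"
  have zero: "f (x + of_nat k - of_nat i) = 0" if "a (x - of_nat j) = 0" "i \<le> j + k" "j + k - i \<le> m" for i j k
  proof -
    have "a (x + of_nat k - of_nat i - of_nat (j + k - i)) = 0"
      using that(1,2) by (simp add: of_nat_diff)
    moreover have "j + k - i \<in> {..<Suc m}" using that(3) by simp
    ultimately show ?thesis
      unfolding f_def falling_power_def by (intro prod_zero bexI[of _ "j + k - i"] finite_lessThan)
  qed
  have "(\<Prod>k<Suc m. a (x - of_nat k)) = 0" using x by (simp only: f_def falling_power_def)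
  then have "\<exists>j\<in>{..<Suc m}. a (x - of_nat j) = 0" by (simp only: prod_zero_iff[OF finite_lessThan])
  then obtain j where "j \<in> {..<Suc m}" and j0: "a (x - of_nat j) = 0" by blast
  then have jm: "j \<le> m" by simp
  \<comment> \<open>The right neighbour belongs to the run unless \<open>x\<close> is its last
    point, \<open>j = m\<close>; then the left one does.\<close>
  have "\<exists>y. f y = 0 \<and> (x = y + 1 \<or> y = x + 1)"
  proof (cases "j < m")
    case True
    then have "f (x + 1) = 0" using zero[OF j0, of 0 1] by simp
    then show ?thesis by blast
  next
    case False
    then have "f (x - 1) = 0" using zero[OF j0, of 1 0] jm m by simp
    moreover have "x = x - 1 + 1" by simp
    ultimately show ?thesis by blast
  qed
  then obtain y where y: "f y = 0" "x = y + 1 \<or> y = x + 1" by blast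
  obtain k where k: "f (y + of_nat k) \<noteq> 0"
    using falling_power_zeros_not_propagating[OF a] unfolding f_def by blast
  obtain l where l: "g (x + of_nat l) \<noteq> 0"
    using falling_power_zeros_not_propagating[OF b] unfolding g_def by blast
  obtain m' where "zero_of_length f y m'" by (rule zero_imp_zero_of_length[OF y(1) k])
  moreover obtain n' where "zero_of_length g x n'" by (rule zero_imp_zero_of_length[OF gx l])
  moreover have "f holomorphic_on UNIV" "g holomorphic_on UNIV"
    unfolding f_def g_def by (intro holomorphic_falling_power a b)+
  ultimately have "\<exists>z0. common_shifting_divisor f g z0"
    using y(2) by (intro adjacent_zeros_common_shifting_divisor) auto
  then show False using prime by (simp add: rel_shifting_prime_def)
qed

text \<open>The casoratian is bilinear and alternating, so a linear relation makes all pairs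
  proportional. General coefficients allow any of the three functions to be placed first, where
  constancy is needed when \<open>m = 1\<close>.\<close>

lemma falling_power_relation_constant:
  fixes a b c :: "complex \<Rightarrow> complex" and m :: nat
  defines "f \<equiv> falling_power a (Suc m)" and "g \<equiv> falling_power b (Suc m)" and "h \<equiv> falling_power c (Suc m)"
  assumes a: "a holomorphic_on UNIV" "growth_order a < 1" "a w \<noteq> 0"
    and b: "b holomorphic_on UNIV" "growth_order b < 1" "b w \<noteq> 0"
    and c: "c holomorphic_on UNIV" "growth_order c < 1" "c w \<noteq> 0"
    and cop: "\<And>z. f z = 0 \<Longrightarrow> g z \<noteq> 0" "\<And>z. f z = 0 \<Longrightarrow> h z \<noteq> 0" "\<And>z. g z = 0 \<Longrightarrow> h z \<noteq> 0"
    and nz: "\<alpha> \<noteq> 0" "\<beta> \<noteq> 0" and eq: "\<And>z. h z = \<alpha> * f z + \<beta> * g z"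
    and m: "m \<ge> 1" "m \<ge> 2 \<or> a constant_on UNIV"
  shows "a constant_on UNIV" "b constant_on UNIV" "c constant_on UNIV"
proof -
  have rel: "casoratian f h z = \<beta> * casoratian f g z" "casoratian g h z = - \<alpha> * casoratian f g z" for z
    by (simp_all add: casoratian_def eq algebra_simps)
  have W: "casoratian f g z = 0" for z
    unfolding f_def g_def
    by (rule falling_casoratian_vanishes[OF a b c cop[unfolded f_def g_def h_def] nz(2) _
          rel[unfolded f_def g_def h_def] m]) (use nz in auto)
  have swap: "casoratian u v z = - casoratian v u z" for u v z
    by (simp add: casoratian_def)
  show "a constant_on UNIV"
    by (rule casoratian_zero_imp_constant[OF a, of m g]) (use W cop in \<open>auto simp: f_def\<close>)
  have "casoratian g f z = 0" "casoratian h f z = 0" for z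
    using W[of z] rel(1)[of z] swap[of g f z] swap[of h f z] by auto
  then show "b constant_on UNIV" "c constant_on UNIV"
    using cop(1,2)
    by (auto simp: g_def h_def intro!: casoratian_zero_imp_constant[OF b, of m f] casoratian_zero_imp_constant[OF c, of m f])
qed

theorem theorem5p1:
  fixes a b c :: "complex \<Rightarrow> complex" and n :: nat
  assumes "a holomorphic_on UNIV" and "b holomorphic_on UNIV" and "c holomorphic_on UNIV"
    and "growth_order a < 1" and "growth_order b < 1" and "growth_order c < 1"
    and "\<exists>z. a z \<noteq> 0" and "\<exists>z. b z \<noteq> 0" and "\<exists>z. c z \<noteq> 0"
    and "\<not> (a constant_on UNIV \<and> b constant_on UNIV \<and> c constant_on UNIV)"
    and "n \<ge> 1"
    and "rel_shifting_prime3 (falling_power a n) (falling_power b n) (falling_power c n)"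
    and "\<forall>z. falling_power a n z + falling_power b n z = falling_power c n z"
  shows "n \<le> 2 \<and> (a constant_on UNIV \<or> b constant_on UNIV \<or> c constant_on UNIV \<longrightarrow> n = 1)"
proof (rule ccontr)
  assume contra: "\<not> ?thesis"
  define m where "m = n - 1"
  \<comment> \<open>The claim holds trivially for \<open>n = 1\<close>, so its failure forces
    \<open>n \<ge> 2\<close>, and in fact \<open>n \<ge> 3\<close> unless one function is
    constant.\<close>
  have n: "n = Suc m" "m \<ge> 1" using contra \<open>n \<ge> 1\<close> by (auto simp: m_def)
  have m: "m \<ge> 2 \<or> a constant_on UNIV \<or> b constant_on UNIV \<or> c constant_on UNIV"
    using contra n by auto
  obtain w where w: "a w \<noteq> 0" "b w \<noteq> 0" "c w \<noteq> 0"
    by (rule common_nonzero[of "{a, b, c}"]) (use assms(1-3,7-9) in auto)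
  note a = assms(1,4) w(1) and b = assms(2,5) w(2) and c = assms(3,6) w(3)
  have prime: "rel_shifting_prime (falling_power a (Suc m)) (falling_power b (Suc m))"
    "rel_shifting_prime (falling_power a (Suc m)) (falling_power c (Suc m))"
    "rel_shifting_prime (falling_power b (Suc m)) (falling_power c (Suc m))"
    using assms(12) by (simp_all add: rel_shifting_prime3_def n)
  note ab = shifting_prime_no_common_zero[OF a b n(2) prime(1)]
    and ac = shifting_prime_no_common_zero[OF a c n(2) prime(2)]
    and bc = shifting_prime_no_common_zero[OF b c n(2) prime(3)]
  have eq: "falling_power c (Suc m) z = falling_power a (Suc m) z + falling_power b (Suc m) z" for z
    using assms(13) by (simp add: n)
  from m have "(m \<ge> 2 \<or> a constant_on UNIV) \<or> (m \<ge> 2 \<or> b constant_on UNIV) \<or> (m \<ge> 2 \<or> c constant_on UNIV)"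
    by blast
  then have "a constant_on UNIV \<and> b constant_on UNIV \<and> c constant_on UNIV"
  proof (elim disjE[of "m \<ge> 2 \<or> a constant_on UNIV"] disjE[of "m \<ge> 2 \<or> b constant_on UNIV"])
    assume *: "m \<ge> 2 \<or> a constant_on UNIV"
    have eq': "falling_power c (Suc m) z = 1 * falling_power a (Suc m) z + 1 * falling_power b (Suc m) z" for z
      by (simp add: eq)
    show ?thesis
      using falling_power_relation_constant[OF a b c ab ac bc _ _ eq' n(2) *] by simp
  next
    assume *: "m \<ge> 2 \<or> b constant_on UNIV"
    have eq': "falling_power c (Suc m) z = 1 * falling_power b (Suc m) z + 1 * falling_power a (Suc m) z" for z
      by (simp add: eq)
    have ba: "falling_power a (Suc m) z \<noteq> 0" if "falling_power b (Suc m) z = 0" for z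
      using ab that by blast
    show ?thesis
      using falling_power_relation_constant[OF b a c ba bc ac _ _ eq' n(2) *] by simp
  next
    assume *: "m \<ge> 2 \<or> c constant_on UNIV"
    \<comment> \<open>To put \<open>c\<close> first, the relation is solved for the falling power of
      \<open>b\<close>, with coefficients 1 and -1.\<close>
    have eq': "falling_power b (Suc m) z = 1 * falling_power c (Suc m) z + (- 1) * falling_power a (Suc m) z" for z
      by (simp add: eq)
    have ca: "falling_power a (Suc m) z \<noteq> 0" if "falling_power c (Suc m) z = 0" for z
      using ac that by blast
    have cb: "falling_power b (Suc m) z \<noteq> 0" if "falling_power c (Suc m) z = 0" for z
      using bc that by blast
    show ?thesis
      using falling_power_relation_constant[OF c a b ca cb ab _ _ eq' n(2) *] by simp
  qed
  with assms(10) show False by blast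
qed

end
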